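(* Let $F\colon \mathbb{N} \to (\mathbb{N}\setminus\{0\})\cup\{\infty\}$. There is a compact $\Pi^0_1(F)$ maximal eventually different family in $\mathcal{N}_F$ if and only if $F(n)<\infty$ for infinitely many $n\in\mathbb{N}$. Moreover, exactly one of the following holds: (1) every maximal eventually different family in $\mathcal{N}_F$ is finite and there is a finite maximal eventually different family in $\mathcal{N}_F$ consisting of constant functions (namely, when $\liminf_{n\to\infty}F(n)<\infty$); (2) there is a perfect $\Pi^0_1(F)$ maximal eventually different family in $\mathcal{N}_F$, but there is no countable maximal eventually different family in $\mathcal{N}_F$.
   Context: For $F\colon \mathbb{N}\to\mathbb{N}\cup\{\infty\}$, let $\mathcal{N}_F = \{g \in {}^{\mathbb{N}}\mathbb{N} \mid (\forall n\in\mathbb{N})\; g(n) < F(n)\}$, where $k<\infty$ for all $k\in\mathbb{N}$, with the product topology of the discrete spaces $\{k\in\mathbb{N}\mid k<F(n)\}$. Limits of $F$ are taken in $\mathbb{N}\cup\{\infty\}$ with the order topology. Two functions $g_0,g_1$ with domain $\mathbb{N}$ are eventually different if $\{n\in\mathbb{N}\mid g_0(n)=g_1(n)\}$ is finite. A set $\mathcal{E}$ is an eventually different family in $\mathcal{N}_F$ if $\mathcal{E}\subseteq\mathcal{N}_F$ and any two distinct elements of $\mathcal{E}$ are eventually different; it is maximal if it is maximal under inclusion among eventually different families in $\mathcal{N}_F$. A set is $\Pi^0_1(F)$ (effectively-in-$F$ closed) if it is the set $[T]$ of infinite branches of a tree $T$ of finite sequences of natural numbers that is recursive in $F$, where $F$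 is regarded as an oracle by coding the value $\infty$ by a fixed symbol that is not a natural number. A set is perfect if it is nonempty, closed and has no isolated points. "Countable" includes finite.
   Formalization: In (1), "constant functions" is read as "constant at all but finitely many n", since the literal claim fails for F(0)=1, F(n)=2 (n>0); literally constant functions are asserted when liminf F is finite and liminf F ≤ F(n) for all n. *)

theory Defs
  imports "HOL-Analysis.Analysis" "HOL-Library.Extended_Nat" "HOL-Library.Liminf_Limsup"
    "HOL-Library.Sublist" "HOL-Library.Nat_Bijection" "HOL-Library.Countable_Set"
begin

section \<open>The space and its eventually different families\<close>

definition NF :: "(nat \<Rightarrow> enat) \<Rightarrow> (nat \<Rightarrow> nat) set" where
  "NF F = {g. \<forall>n. enat (g n) < F n}"

(* Its underlying set is NF F. *)
definition NF_topology :: "(nat \<Rightarrow> enat) \<Rightarrow> (nat \<Rightarrow> nat) topology" where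
  "NF_topology F = product_topology (\<lambda>n. discrete_topology {k. enat k < F n}) UNIV"

lemma topspace_NF_topology: "topspace (NF_topology F) = NF F"
  by (auto simp: NF_topology_def NF_def PiE_iff)

definition eventually_different :: "(nat \<Rightarrow> nat) \<Rightarrow> (nat \<Rightarrow> nat) \<Rightarrow> bool" where
  "eventually_different g h \<longleftrightarrow> finite {n. g n = h n}"

definition ed_family :: "(nat \<Rightarrow> enat) \<Rightarrow> (nat \<Rightarrow> nat) set \<Rightarrow> bool" where
  "ed_family F E \<longleftrightarrow>
     E \<subseteq> NF F \<and> (\<forall>g\<in>E. \<forall>h\<in>E. g \<noteq> h \<longrightarrow> eventually_different g h)"

definition med_family :: "(nat \<Rightarrow> enat) \<Rightarrow> (nat \<Rightarrow> nat) set \<Rightarrow> bool" where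
  "med_family F E \<longleftrightarrow>
     ed_family F E \<and> (\<forall>E'. ed_family F E' \<and> E \<subseteq> E' \<longrightarrow> E' = E)"

definition perfect_in :: "'a topology \<Rightarrow> 'a set \<Rightarrow> bool" where
  "perfect_in X A \<longleftrightarrow> A \<noteq> {} \<and> closedin X A \<and>
     (\<forall>x\<in>A. \<not> (\<exists>U. openin X U \<and> U \<inter> A = {x}))"

definition constant_fun :: "(nat \<Rightarrow> nat) \<Rightarrow> bool" where
  "constant_fun g \<longleftrightarrow> (\<exists>c. \<forall>n. g n = c)"

definition eventually_constant_fun :: "(nat \<Rightarrow> nat) \<Rightarrow> bool" where
  "eventually_constant_fun g \<longleftrightarrow> (\<exists>c. finite {n. g n \<noteq> c})"


section \<open>Recursiveness relative to an oracle\<close>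

(* Kleene's mu-recursive partial functions of several arguments with an oracle function.
   Recursion is on the first argument; Mu searches for the least first argument at which
   its body vanishes, the body being defined at all smaller arguments. *)
datatype orec =
    Zero
  | Succ
  | Proj nat
  | Oracle
  | Comp orec "orec list"
  | PrimRec orec orec
  | Mu orec

inductive orec_eval :: "(nat \<Rightarrow> nat) \<Rightarrow> orec \<Rightarrow> nat list \<Rightarrow> nat \<Rightarrow> bool"
  for A :: "nat \<Rightarrow> nat" where
  Zero: "orec_eval A Zero xs 0"
| Succ: "orec_eval A Succ [x] (Suc x)"
| Proj: "i < length xs \<Longrightarrow> orec_eval A (Proj i) xs (xs ! i)"
| Oracle: "orec_eval A Oracle [x] (A x)"
| Comp: "list_all2 (\<lambda>g y. orec_eval A g xs y) gs ys \<Longrightarrow> orec_eval A f ys z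
    \<Longrightarrow> orec_eval A (Comp f gs) xs z"
| PrimRec_0: "orec_eval A f xs y \<Longrightarrow> orec_eval A (PrimRec f g) (0 # xs) y"
| PrimRec_Suc: "orec_eval A (PrimRec f g) (n # xs) r \<Longrightarrow> orec_eval A g (n # r # xs) y
    \<Longrightarrow> orec_eval A (PrimRec f g) (Suc n # xs) y"
| Mu: "orec_eval A f (m # xs) 0 \<Longrightarrow> (\<forall>i<m. \<exists>y. orec_eval A f (i # xs) (Suc y))
    \<Longrightarrow> orec_eval A (Mu f) xs m"

inductive_cases orec_eval_ZeroE: "orec_eval A Zero xs y"
inductive_cases orec_eval_SuccE: "orec_eval A Succ xs y"
inductive_cases orec_eval_ProjE: "orec_eval A (Proj i) xs y"
inductive_cases orec_eval_OracleE: "orec_eval A Oracle xs y"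
inductive_cases orec_eval_CompE: "orec_eval A (Comp f gs) xs y"
inductive_cases orec_eval_PrimRec_0E: "orec_eval A (PrimRec f g) (0 # xs) y"
inductive_cases orec_eval_PrimRec_SucE: "orec_eval A (PrimRec f g) (Suc n # xs) y"
inductive_cases orec_eval_MuE: "orec_eval A (Mu f) xs y"

lemma orec_eval_deterministic:
  "orec_eval A p xs y \<Longrightarrow> orec_eval A p xs z \<Longrightarrow> y = z"
proof (induction arbitrary: z rule: orec_eval.induct)
  case (Comp xs gs ys f w)
  from Comp.prems obtain ys' where ys': "list_all2 (\<lambda>g y. orec_eval A g xs y) gs ys'"
    and z: "orec_eval A f ys' z"
    by (elim orec_eval_CompE)
  have "ys = ys'"
    using Comp.IH(1) ys' by (intro nth_equalityI) (simp_all add: list_all2_conv_all_nth)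
  then show ?case using z Comp.IH(2) by blast
next
  case (PrimRec_Suc f g n xs r y)
  from PrimRec_Suc.prems show ?case
    by (elim orec_eval_PrimRec_SucE) (use PrimRec_Suc.IH in blast)
next
  case (Mu f m xs)
  from Mu.prems have z: "orec_eval A f (z # xs) 0"
    and below: "\<forall>i<z. \<exists>y. orec_eval A f (i # xs) (Suc y)"
    by (elim orec_eval_MuE, simp)+
  show ?case
  proof (rule linorder_cases[of m z])
    assume "m < z"
    with below obtain y where "orec_eval A f (m # xs) (Suc y)" by blast
    with Mu.IH(1) show ?thesis by blast
  next
    assume "z < m"
    with Mu.IH(2) z show ?thesis by blast
  qed
qed (blast elim: orec_eval_ZeroE orec_eval_SuccE orec_eval_ProjE orec_eval_OracleE
      orec_eval_PrimRec_0E)+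

(* F as an oracle with natural-number answers: 0 stands for the value infinity and is
   kept apart from the finite values by shifting these up by one. *)
definition oracle_of :: "(nat \<Rightarrow> enat) \<Rightarrow> nat \<Rightarrow> nat" where
  "oracle_of F n = (case F n of enat k \<Rightarrow> Suc k | \<infinity> \<Rightarrow> 0)"

(* The characteristic function of the set of codes is recursive in the oracle; list_encode
   is an effective bijection between finite sequences and natural numbers. *)
definition recursive_in :: "(nat \<Rightarrow> enat) \<Rightarrow> nat list set \<Rightarrow> bool" where
  "recursive_in F T \<longleftrightarrow>
     (\<exists>p. \<forall>s. orec_eval (oracle_of F) p [list_encode s] (if s \<in> T then 1 else 0))"

definition is_tree :: "nat list set \<Rightarrow> bool" where
  "is_tree T \<longleftrightarrow> (\<forall>t\<in>T. \<forall>s. prefix s t \<longrightarrow> s \<in> T)"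

definition branches :: "nat list set \<Rightarrow> (nat \<Rightarrow> nat) set" where
  "branches T = {g. \<forall>n. map g [0..<n] \<in> T}"

definition Pi01 :: "(nat \<Rightarrow> enat) \<Rightarrow> (nat \<Rightarrow> nat) set \<Rightarrow> bool" where
  "Pi01 F C \<longleftrightarrow> (\<exists>T. is_tree T \<and> recursive_in F T \<and> C = branches T)"


section \<open>The two alternatives\<close>

(* Only eventual constancy can be asked for in general: if F takes values below its limit
   inferior, then constant functions in NF F are too few to form a maximal family.
   For instance, let F 0 = 1 and F n = 2 for n > 0; the only constant function in NF F is
   zero, and it is eventually different from the function that is 0 at 0 and 1 elsewhere. *)
definition all_med_finite :: "(nat \<Rightarrow> enat) \<Rightarrow> bool" where
  "all_med_finite F \<longleftrightarrow>
     (\<forall>E. med_family F E \<longrightarrow> finite E) \<and>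
     (\<exists>E. med_family F E \<and> finite E \<and> (\<forall>g\<in>E. eventually_constant_fun g))"

definition perfect_med_none_countable :: "(nat \<Rightarrow> enat) \<Rightarrow> bool" where
  "perfect_med_none_countable F \<longleftrightarrow>
     (\<exists>E. med_family F E \<and> perfect_in (NF_topology F) E \<and> Pi01 F E) \<and>
     \<not> (\<exists>E. med_family F E \<and> countable E)"

end

theory Submission
  imports Defs
begin

text \<open>
  Everything depends on the limit inferior of F. If it is a finite number K, then F has the value K
  at infinitely many places and is smaller at only finitely many. By the pigeonhole principle an
  eventually different family has at most K members, and the K constant functions with values below
  K, cut down at the few places where F is smaller, form a maximal one
  (lemmas ed_family_finite, med_family_trunc).

  Otherwise F tends to infinity. A diagonal function is eventually different from countably many
  given ones, so no maximal family is countable (med_family_uncountable), and the task is to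
  construct a perfect, effectively closed maximal family. The starting point is the map that sends
  a function \<psi> to the function whose value at n is a code of an initial segment of \<psi>: distinct
  functions have eventually different images. To become maximal, the images are modified so that
  every f is met infinitely often by some member. To each f belongs an infinite set of marked
  positions, and the sets of distinct functions are almost disjoint. The values of f at its
  marked positions, read as codes of finite sequences and ordered by extension, form a tree.

  If a node q of this tree has infinitely many children, then the member with parameter (f, q)
  copies f at these children. They are pairwise incomparable, so the copied values meet any
  other coding function at most once and the family remains eventually different. If
  every node has only finitely many children, then by Koenig's lemma there is an infinite branch,
  that is, some \<psi> whose codes agree with f infinitely often at marked positions of f. The member
  belonging to \<psi> still meets f infinitely often, since it copies at only finitely many of these
  positions or else copies f itself (val_eventually_different,
  finite_children_imp_infinite_branch, val_meets).

  A node is the place of the only odd value in a sequence \<phi>, and f is obtained from \<phi> by halving; in this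
  way one sequence codes the whole parameter, and a parameter need not have a node. Nothing is
  ever copied at positions of even index, so the parameter can be read off from a member there.
  All remaining values are then determined by bounded conditions, and the family is the set of
  branches of a tree recursive in F (branches_tree, recursive_tree).

  Codes have to stay below F, so their lengths are adapted to F, and only the restriction of f to a
  suitable sequence of positions is considered. If F is finite infinitely often, these positions are
  found by a search relative to F for places where F is finite but large enough; the resulting
  family is bounded at each place and thus compact. If F is finite only finitely often, the positions are those of a final
  segment where F is infinite. A compact maximal family cannot exist in that case, because a
  function above all its members at almost all places could be added
  (compact_med_imp_infinite_finite_values).
\<close>

section \<open>Total functions recursive in an oracle\<close>

text \<open>
  Programs are evaluated on argument lists of a fixed length k, and functions are written as
  terms over that list. The closure rules below then derive the recursiveness of a function by
  following the syntax of the term that defines it.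
\<close>

definition recf :: "(nat \<Rightarrow> nat) \<Rightarrow> nat \<Rightarrow> (nat list \<Rightarrow> nat) \<Rightarrow> bool" where
  "recf A k f \<longleftrightarrow> (\<exists>p. \<forall>xs. length xs = k \<longrightarrow> orec_eval A p xs (f xs))"

definition recp :: "(nat \<Rightarrow> nat) \<Rightarrow> nat \<Rightarrow> (nat list \<Rightarrow> bool) \<Rightarrow> bool" where
  "recp A k P \<longleftrightarrow> recf A k (\<lambda>xs. if P xs then 1 else 0)"

lemma recf_cong:
  assumes "\<And>xs. length xs = k \<Longrightarrow> f xs = g xs"
  shows "recf A k f \<longleftrightarrow> recf A k g"
  using assms unfolding recf_def by metis

lemma recf_compose:
  assumes "recf A (length fs) g" "\<forall>f\<in>set fs. recf A k f"
  shows "recf A k (\<lambda>xs. g (map (\<lambda>f. f xs) fs))"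
proof -
  obtain p where p: "\<And>ys. length ys = length fs \<Longrightarrow> orec_eval A p ys (g ys)"
    using assms(1) unfolding recf_def by blast
  obtain q where q: "\<And>f xs. f \<in> set fs \<Longrightarrow> length xs = k \<Longrightarrow> orec_eval A (q f) xs (f xs)"
    using assms(2) unfolding recf_def by metis
  show ?thesis
    unfolding recf_def
  proof (intro exI[of _ "Comp p (map q fs)"] allI impI)
    fix xs :: "nat list"
    assume "length xs = k"
    then show "orec_eval A (Comp p (map q fs)) xs (g (map (\<lambda>f. f xs) fs))"
      by (intro orec_eval.Comp[where ys = "map (\<lambda>f. f xs) fs"] p)
         (simp_all add: list_all2_conv_all_nth q)
  qed
qed

lemma recf_app1:
  assumes "recf A 1 (\<lambda>ys. u (ys ! 0))" "recf A k f"
  shows "recf A k (\<lambda>xs. u (f xs))"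
  using recf_compose[of A "[f]" "\<lambda>ys. u (ys ! 0)" k] assms by simp

lemma recf_app2:
  assumes "recf A 2 (\<lambda>ys. u (ys ! 0) (ys ! 1))" "recf A k f" "recf A k g"
  shows "recf A k (\<lambda>xs. u (f xs) (g xs))"
  using recf_compose[of A "[f, g]" "\<lambda>ys. u (ys ! 0) (ys ! 1)" k] assms
  by (simp add: numeral_2_eq_2)

lemma recf_app3:
  assumes "recf A 3 (\<lambda>ys. u (ys ! 0) (ys ! 1) (ys ! 2))" "recf A k f" "recf A k g" "recf A k h"
  shows "recf A k (\<lambda>xs. u (f xs) (g xs) (h xs))"
  using recf_compose[of A "[f, g, h]" "\<lambda>ys. u (ys ! 0) (ys ! 1) (ys ! 2)" k] assms
  by (simp add: numeral_3_eq_3 numeral_2_eq_2)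

lemma recp_app1:
  assumes "recp A 1 (\<lambda>ys. P (ys ! 0))" "recf A k f"
  shows "recp A k (\<lambda>xs. P (f xs))"
  using recf_app1[of A "\<lambda>x. if P x then 1 else 0"] assms unfolding recp_def by simp

lemma recp_app2:
  assumes "recp A 2 (\<lambda>ys. P (ys ! 0) (ys ! 1))" "recf A k f" "recf A k g"
  shows "recp A k (\<lambda>xs. P (f xs) (g xs))"
  using recf_app2[of A "\<lambda>x y. if P x y then 1 else 0"] assms unfolding recp_def by simp

lemma recp_app3:
  assumes "recp A 3 (\<lambda>ys. P (ys ! 0) (ys ! 1) (ys ! 2))" "recf A k f" "recf A k g" "recf A k h"
  shows "recp A k (\<lambda>xs. P (f xs) (g xs) (h xs))"
  using recf_app3[of A "\<lambda>x y z. if P x y z then 1 else 0"] assms unfolding recp_def by simp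

text \<open>
  Below, a quantifier or a recursion adds its variable at the front of the argument list, so that
  under n binders the variables appear as hd of an iterated tail and as entries of the n-th tail.
\<close>

lemma recf_drop_nth: "j + i < k \<Longrightarrow> recf A k (\<lambda>xs. drop j xs ! i)"
  unfolding recf_def
proof (intro exI[of _ "Proj (j + i)"] allI impI)
  fix xs :: "nat list"
  assume "j + i < k" "length xs = k"
  then show "orec_eval A (Proj (j + i)) xs (drop j xs ! i)"
    using orec_eval.Proj[of "j + i" xs A] by simp
qed

lemma recf_hd_drop:
  assumes "j < k"
  shows "recf A k (\<lambda>xs. hd (drop j xs))"
  using recf_drop_nth[of j 0 k A] assms
  by (subst recf_cong[where g = "\<lambda>xs. drop j xs ! 0"]) (auto simp: hd_drop_conv_nth)

lemma recf_var:
  "i < k \<Longrightarrow> recf A k (\<lambda>xs. xs ! i)"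
  "Suc i < k \<Longrightarrow> recf A k (\<lambda>xs. tl xs ! i)"
  "Suc (Suc i) < k \<Longrightarrow> recf A k (\<lambda>xs. tl (tl xs) ! i)"
  "Suc (Suc (Suc i)) < k \<Longrightarrow> recf A k (\<lambda>xs. tl (tl (tl xs)) ! i)"
  "0 < k \<Longrightarrow> recf A k (\<lambda>xs. hd xs)"
  "Suc 0 < k \<Longrightarrow> recf A k (\<lambda>xs. hd (tl xs))"
  "Suc (Suc 0) < k \<Longrightarrow> recf A k (\<lambda>xs. hd (tl (tl xs)))"
  using recf_drop_nth[of 0 i k A] recf_drop_nth[of 1 i k A] recf_drop_nth[of 2 i k A]
    recf_drop_nth[of 3 i k A] recf_hd_drop[of 0 k A] recf_hd_drop[of 1 k A] recf_hd_drop[of 2 k A]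
  by (simp_all add: drop_Suc numeral_2_eq_2 numeral_3_eq_3 del: drop_Suc_Cons)

lemma recf_Suc: "recf A k f \<Longrightarrow> recf A k (\<lambda>xs. Suc (f xs))"
proof (rule recf_app1[of A Suc])
  show "recf A 1 (\<lambda>ys. Suc (ys ! 0))"
    unfolding recf_def
    by (intro exI[of _ Succ]) (auto simp: length_Suc_conv intro: orec_eval.Succ)
qed

lemma recf_oracle: "recf A k f \<Longrightarrow> recf A k (\<lambda>xs. A (f xs))"
proof (rule recf_app1[of A A])
  show "recf A 1 (\<lambda>ys. A (ys ! 0))"
    unfolding recf_def
    by (intro exI[of _ Oracle]) (auto simp: length_Suc_conv intro: orec_eval.Oracle)
qed

lemma recf_const: "recf A k (\<lambda>xs. c)"
proof (induction c)
  case 0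
  show ?case unfolding recf_def by (blast intro: orec_eval.Zero)
next
  case (Suc c)
  then show ?case by (rule recf_Suc)
qed

lemma recf_rec_nat_first:
  assumes b: "recf A k b"
    and s: "recf A (Suc (Suc k)) (\<lambda>ys. st (hd ys) (hd (tl ys)) (tl (tl ys)))"
  shows "recf A (Suc k) (\<lambda>ys. rec_nat (b (tl ys)) (\<lambda>i r. st i r (tl ys)) (hd ys))"
proof -
  obtain p where p: "\<And>xs. length xs = k \<Longrightarrow> orec_eval A p xs (b xs)"
    using b unfolding recf_def by blast
  obtain q where q: "\<And>ys. length ys = Suc (Suc k) \<Longrightarrow>
      orec_eval A q ys (st (hd ys) (hd (tl ys)) (tl (tl ys)))"
    using s unfolding recf_def by blast
  have "orec_eval A (PrimRec p q) (n # xs) (rec_nat (b xs) (\<lambda>i r. st i r xs) n)"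
    if "length xs = k" for n xs
  proof (induction n)
    case 0
    show ?case using p[OF that] by (simp add: orec_eval.PrimRec_0)
  next
    case (Suc n)
    show ?case
      using q[of "n # rec_nat (b xs) (\<lambda>i r. st i r xs) n # xs"] that
      by (auto intro!: orec_eval.PrimRec_Suc[OF Suc])
  qed
  then show ?thesis
    unfolding recf_def by (intro exI[of _ "PrimRec p q"]) (auto simp: length_Suc_conv)
qed

text \<open>
  The program for a recursion takes the number of steps as its first argument. Composition with
  all the projections lets an arbitrary recursive function supply that number.
\<close>

lemma recf_subst_first:
  assumes "recf A (Suc k) (\<lambda>ys. g (hd ys) (tl ys))" "recf A k n"
  shows "recf A k (\<lambda>xs. g (n xs) xs)"
proof -
  have "recf A k (\<lambda>xs. (\<lambda>ys. g (hd ys) (tl ys)) (map (\<lambda>f. f xs) (n # map (\<lambda>i xs. xs ! i) [0..<k])))"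
    using assms
    by (intro recf_compose) (auto intro!: recf_var)
  moreover have "map (\<lambda>i. xs ! i) [0..<k] = xs" if "length xs = k" for xs :: "nat list"
    using that by (metis map_nth)
  ultimately show ?thesis
    by (subst recf_cong[where g = "\<lambda>xs. g (n xs) (map (\<lambda>i. xs ! i) [0..<k])"]) (auto simp: o_def)
qed

lemma recf_rec_nat:
  assumes "recf A k b" "recf A (Suc (Suc k)) (\<lambda>ys. st (hd ys) (hd (tl ys)) (tl (tl ys)))"
    "recf A k n"
  shows "recf A k (\<lambda>xs. rec_nat (b xs) (\<lambda>i r. st i r xs) (n xs))"
  by (rule recf_subst_first[OF recf_rec_nat_first[OF assms(1,2)] assms(3)])

lemma recf_Least_0:
  assumes g: "recf A (Suc k) (\<lambda>ys. g (hd ys) (tl ys))"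
    and ex: "\<And>xs. length xs = k \<Longrightarrow> \<exists>i. g i xs = 0"
  shows "recf A k (\<lambda>xs. LEAST i. g i xs = 0)"
proof -
  obtain p where p: "\<And>ys. length ys = Suc k \<Longrightarrow> orec_eval A p ys (g (hd ys) (tl ys))"
    using g unfolding recf_def by blast
  show ?thesis
    unfolding recf_def
  proof (intro exI[of _ "Mu p"] allI impI)
    fix xs :: "nat list"
    assume xs: "length xs = k"
    define m where "m = (LEAST i. g i xs = 0)"
    have pi: "orec_eval A p (i # xs) (g i xs)" for i
      using p[of "i # xs"] xs by simp
    have "g m xs = 0"
      unfolding m_def using ex[OF xs] by (rule LeastI_ex)
    moreover have "\<exists>y. g i xs = Suc y" if "i < m" for i
      using not_less_Least[of i "\<lambda>i. g i xs = 0"] that by (simp add: m_def not0_implies_Suc)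
    ultimately have "orec_eval A (Mu p) xs m"
      by (intro orec_eval.Mu) (metis pi)+
    then show "orec_eval A (Mu p) xs (LEAST i. g i xs = 0)"
      by (simp add: m_def)
  qed
qed

lemma recf_add:
  assumes "recf A k f" "recf A k g"
  shows "recf A k (\<lambda>xs. f xs + g xs)"
proof -
  have "recf A k (\<lambda>xs. rec_nat (f xs) (\<lambda>i r. Suc r) (g xs))"
    using assms by (intro recf_rec_nat recf_Suc recf_var) auto
  moreover have "rec_nat a (\<lambda>i r. Suc r) b = a + b" for a b :: nat
    by (induction b) auto
  ultimately show ?thesis by simp
qed

lemma recf_mult:
  assumes "recf A k f" "recf A k g"
  shows "recf A k (\<lambda>xs. f xs * g xs)"
proof -
  have "recf A 2 (\<lambda>xs. rec_nat 0 (\<lambda>i r. r + xs ! 0) (xs ! 1))"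
    by (intro recf_rec_nat recf_add recf_const recf_var) auto
  moreover have "rec_nat 0 (\<lambda>i r. r + a) b = a * b" for a b :: nat
    by (induction b) auto
  ultimately have "recf A 2 (\<lambda>xs. xs ! 0 * xs ! 1)" by simp
  from recf_app2[OF this assms] show ?thesis .
qed

lemma recf_pred:
  assumes "recf A k f"
  shows "recf A k (\<lambda>xs. f xs - 1)"
proof -
  have "recf A k (\<lambda>xs. rec_nat 0 (\<lambda>i r. i) (f xs))"
    using assms by (intro recf_rec_nat recf_const recf_var) auto
  moreover have "rec_nat 0 (\<lambda>i r. i) b = b - 1" for b :: nat
    by (cases b) auto
  ultimately show ?thesis by simp
qed

lemma recf_diff:
  assumes "recf A k f" "recf A k g"
  shows "recf A k (\<lambda>xs. f xs - g xs)"
proof -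
  have "recf A k (\<lambda>xs. rec_nat (f xs) (\<lambda>i r. r - 1) (g xs))"
    using assms by (intro recf_rec_nat recf_pred recf_var) auto
  moreover have "rec_nat a (\<lambda>i r. r - 1) b = a - b" for a b :: nat
    by (induction b) auto
  ultimately show ?thesis by simp
qed

lemma recf_if:
  assumes "recp A k P" "recf A k f" "recf A k g"
  shows "recf A k (\<lambda>xs. if P xs then f xs else g xs)"
proof -
  have "recf A k (\<lambda>xs. (if P xs then 1 else 0) * f xs + (1 - (if P xs then 1 else 0)) * g xs)"
    using assms unfolding recp_def by (intro recf_add recf_mult recf_diff recf_const)
  then show ?thesis
    by (rule recf_cong[THEN iffD1, rotated]) simp
qed

lemma recp_not:
  assumes "recp A k P"
  shows "recp A k (\<lambda>xs. \<not> P xs)"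
proof -
  have "recf A k (\<lambda>xs. if P xs then 0 else 1)"
    using assms by (intro recf_if recf_const)
  then show ?thesis
    unfolding recp_def by (rule recf_cong[THEN iffD1, rotated]) simp
qed

lemma recp_conj:
  assumes "recp A k P" "recp A k Q"
  shows "recp A k (\<lambda>xs. P xs \<and> Q xs)"
proof -
  have "recf A k (\<lambda>xs. if P xs then (if Q xs then 1 else 0) else 0)"
    using assms by (intro recf_if recf_const)
  then show ?thesis
    unfolding recp_def by (rule recf_cong[THEN iffD1, rotated]) simp
qed

lemma recp_disj:
  assumes "recp A k P" "recp A k Q"
  shows "recp A k (\<lambda>xs. P xs \<or> Q xs)"
  using recp_not[OF recp_conj[OF recp_not[OF assms(1)] recp_not[OF assms(2)]]] by simp

lemma recp_imp:
  assumes "recp A k P" "recp A k Q"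
  shows "recp A k (\<lambda>xs. P xs \<longrightarrow> Q xs)"
  unfolding imp_conv_disj using recp_disj[OF recp_not[OF assms(1)] assms(2)] .

lemma recp_le:
  assumes "recf A k f" "recf A k g"
  shows "recp A k (\<lambda>xs. f xs \<le> g xs)"
proof -
  have "recf A k (\<lambda>xs. 1 - (f xs - g xs))"
    using assms by (intro recf_diff recf_const)
  then show ?thesis
    unfolding recp_def by (rule recf_cong[THEN iffD1, rotated]) simp
qed

lemma recp_less:
  assumes "recf A k f" "recf A k g"
  shows "recp A k (\<lambda>xs. f xs < g xs)"
  using recp_le[OF recf_Suc[OF assms(1)] assms(2)] by (simp add: Suc_le_eq)

lemma recp_eq:
  assumes "recf A k f" "recf A k g"
  shows "recp A k (\<lambda>xs. f xs = g xs)"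
  using recp_conj[OF recp_le[OF assms] recp_le[OF assms(2,1)]] by (simp add: eq_iff)

text \<open>
  A recursion on the bound keeps the value 1 until a counterexample has been seen.
\<close>

lemma recp_all_less:
  assumes "recf A k b" "recp A (Suc k) (\<lambda>ys. P (hd ys) (tl ys))"
  shows "recp A k (\<lambda>xs. \<forall>i<b xs. P i xs)"
proof -
  define B :: "nat list \<Rightarrow> nat \<Rightarrow> nat" where
    "B xs = rec_nat 1 (\<lambda>i r. if P i xs then r else 0)" for xs
  \<comment> \<open>Inside the recursion the previous value sits between the bound variable and the other arguments.\<close>
  have P: "recp A (Suc (Suc k)) (\<lambda>ys. P (hd ys) (tl (tl ys)))"
  proof -
    let ?g = "\<lambda>xs. if P (hd xs) (tl xs) then 1 else 0 :: nat"
    let ?fs = "(\<lambda>ys. ys ! 0) # map (\<lambda>i ys. ys ! (Suc (Suc i))) [0..<k]"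
    have "recf A (Suc (Suc k)) (\<lambda>ys. ?g (map (\<lambda>f. f ys) ?fs))"
      using assms(2) unfolding recp_def
      by (intro recf_compose) (auto intro!: recf_var)
    moreover have "map (\<lambda>f. f ys) ?fs = hd ys # tl (tl ys)" if "length ys = Suc (Suc k)" for ys :: "nat list"
      using that by (intro nth_equalityI) (auto simp: nth_Cons nth_tl hd_conv_nth neq_Nil_conv length_Suc_conv split: nat.splits)
    ultimately show ?thesis
      unfolding recp_def by (elim recf_cong[THEN iffD1, rotated]) (simp only: list.sel)
  qed
  have "recf A k (\<lambda>xs. B xs (b xs))"
    unfolding B_def using assms(1) P
    by (intro recf_rec_nat recf_if recf_const recf_var) auto
  moreover have "B xs n = (if \<forall>i<n. P i xs then 1 else 0)" for xs n
    by (induction n) (auto simp: B_def less_Suc_eq)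
  ultimately show ?thesis unfolding recp_def by simp
qed

lemma recp_ex_less:
  assumes "recf A k b" "recp A (Suc k) (\<lambda>ys. P (hd ys) (tl ys))"
  shows "recp A k (\<lambda>xs. \<exists>i<b xs. P i xs)"
  using recp_not[OF recp_all_less[OF assms(1) recp_not[OF assms(2)]]] by simp

lemma recf_Least:
  assumes "recp A (Suc k) (\<lambda>ys. P (hd ys) (tl ys))"
    and "\<And>xs. length xs = k \<Longrightarrow> \<exists>i. P i xs"
  shows "recf A k (\<lambda>xs. LEAST i. P i xs)"
proof -
  have eq: "((if \<not> P i xs then 1 else 0 :: nat) = 0) = P i xs" for i xs
    by simp
  show ?thesis
    using recf_Least_0[of A k "\<lambda>i xs. if \<not> P i xs then 1 else 0"] recp_not[OF assms(1)] assms(2)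
    unfolding recp_def eq by blast
qed

lemmas rec_intros = recf_const recf_var recf_Suc recf_oracle
  recf_add recf_mult recf_pred recf_diff recf_if recp_not recp_conj recp_disj recp_imp
  recp_le recp_less recp_eq recp_all_less recp_ex_less

lemma recp_even:
  assumes "recf A k f"
  shows "recp A k (\<lambda>xs. even (f xs))"
proof -
  have "recp A 1 (\<lambda>ys. \<exists>i<Suc (ys ! 0). ys ! 0 = 2 * i)"
    by (intro rec_intros) auto
  moreover have "(\<exists>i<Suc n. n = 2 * i) \<longleftrightarrow> even n" for n :: nat
    by (auto elim!: evenE)
  ultimately have "recp A 1 (\<lambda>ys. even (ys ! 0))" by simp
  from recp_app1[OF this assms] show ?thesis .
qed

lemma recf_half:
  assumes "recf A k f"
  shows "recf A k (\<lambda>xs. f xs div 2)"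
proof -
  have "recf A 1 (\<lambda>ys. LEAST i. ys ! 0 < 2 * Suc i)"
  proof (rule recf_Least)
    show "recp A (Suc 1) (\<lambda>ys. tl ys ! 0 < 2 * Suc (hd ys))"
      by (intro rec_intros) auto
    show "\<exists>i. xs ! 0 < 2 * Suc i" for xs :: "nat list"
      by (rule exI[of _ "xs ! 0"]) simp
  qed
  moreover have "(LEAST i. n < 2 * Suc i) = n div 2" for n :: nat
    by (rule Least_equality) auto
  ultimately have "recf A 1 (\<lambda>ys. ys ! 0 div 2)" by simp
  from recf_app1[OF this assms] show ?thesis .
qed

lemma recf_prod_encode:
  assumes "recf A k f" "recf A k g"
  shows "recf A k (\<lambda>xs. prod_encode (f xs, g xs))"
proof -
  have "recf A k (\<lambda>xs. (f xs + g xs) * Suc (f xs + g xs) div 2 + f xs)"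
    using assms by (intro recf_half rec_intros)
  then show ?thesis by (simp add: prod_encode_def triangle_def)
qed

text \<open>
  Both components of a pair are bounded by its code, so decoding is a search through all pairs.
\<close>

lemma recf_prod_decode:
  assumes "recf A k f"
  shows "recf A k (\<lambda>xs. fst (prod_decode (f xs)))"
    and "recf A k (\<lambda>xs. snd (prod_decode (f xs)))"
proof -
  have ex: "\<exists>a. \<exists>b<Suc n. prod_encode (a, b) = n" "\<exists>b. \<exists>a<Suc n. prod_encode (a, b) = n" for n
    by (metis le_imp_less_Suc le_prod_encode_1 le_prod_encode_2 prod_decode_inverse surj_pair)+
  have eq1: "(LEAST a. \<exists>b<Suc n. prod_encode (a, b) = n) = fst (prod_decode n)" for n
  proof -
    obtain b where "prod_encode (LEAST a. \<exists>b<Suc n. prod_encode (a, b) = n, b) = n"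
      using LeastI_ex[OF ex(1)[of n]] by blast
    from arg_cong[OF this, of "\<lambda>v. fst (prod_decode v)"] show ?thesis
      by (simp only: prod_encode_inverse fst_conv)
  qed
  have eq2: "(LEAST b. \<exists>a<Suc n. prod_encode (a, b) = n) = snd (prod_decode n)" for n
  proof -
    obtain a where "prod_encode (a, LEAST b. \<exists>a<Suc n. prod_encode (a, b) = n) = n"
      using LeastI_ex[OF ex(2)[of n]] by blast
    from arg_cong[OF this, of "\<lambda>v. snd (prod_decode v)"] show ?thesis
      by (simp only: prod_encode_inverse snd_conv)
  qed
  have "recf A 1 (\<lambda>ys. LEAST a. \<exists>b<Suc (ys ! 0). prod_encode (a, b) = ys ! 0)"
    by (rule recf_Least[OF _ ex(1)]) (intro rec_intros recf_prod_encode; simp)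
  then have 1: "recf A 1 (\<lambda>ys. fst (prod_decode (ys ! 0)))" by (simp only: eq1)
  have "recf A 1 (\<lambda>ys. LEAST b. \<exists>a<Suc (ys ! 0). prod_encode (a, b) = ys ! 0)"
    by (rule recf_Least[OF _ ex(2)]) (intro rec_intros recf_prod_encode; simp)
  then have 2: "recf A 1 (\<lambda>ys. snd (prod_decode (ys ! 0)))" by (simp only: eq2)
  show "recf A k (\<lambda>xs. fst (prod_decode (f xs)))"
    by (rule recf_app1[OF 1 assms])
  show "recf A k (\<lambda>xs. snd (prod_decode (f xs)))"
    by (rule recf_app1[OF 2 assms])
qed

definition list_drop :: "nat \<Rightarrow> nat \<Rightarrow> nat" where
  "list_drop v i = list_encode (drop i (list_decode v))"

definition list_len :: "nat \<Rightarrow> nat" where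
  "list_len v = length (list_decode v)"

text \<open>
  A nonempty list has the code Suc (prod_encode (head, code of the tail)); the entry is thus read
  off after dropping the entries before it.
\<close>

definition list_nth :: "nat \<Rightarrow> nat \<Rightarrow> nat" where
  "list_nth v i = fst (prod_decode (list_drop v i - 1))"

lemma list_nth_eq: "i < list_len v \<Longrightarrow> list_nth v i = list_decode v ! i"
  unfolding list_nth_def list_drop_def list_len_def
  by (subst Cons_nth_drop_Suc[symmetric]) auto

lemma recf_list_drop:
  assumes "recf A k f" "recf A k g"
  shows "recf A k (\<lambda>xs. list_drop (f xs) (g xs))"
proof -
  have "recf A k (\<lambda>xs. rec_nat (f xs) (\<lambda>i r. snd (prod_decode (r - 1))) (g xs))"
    using assms by (intro recf_rec_nat recf_prod_decode rec_intros) auto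
  moreover have tl: "snd (prod_decode (v - 1)) = list_encode (tl (list_decode v))" for v
  proof (cases "list_decode v")
    case Nil
    then have "v = 0"
      by (metis list_decode_inverse list_encode.simps(1))
    then show ?thesis
      by (simp add: prod_decode_def prod_decode_aux.simps)
  next
    case (Cons x xs)
    then have "v = Suc (prod_encode (x, list_encode xs))"
      by (metis list_decode_inverse list_encode.simps(2))
    then show ?thesis by (simp add: Cons)
  qed
  have "rec_nat v (\<lambda>i r. snd (prod_decode (r - 1))) n = list_drop v n" for v n
    by (induction n) (simp_all add: tl[simplified] list_drop_def drop_Suc tl_drop)
  ultimately show ?thesis by simp
qed

lemma recf_list_len:
  assumes "recf A k f"
  shows "recf A k (\<lambda>xs. list_len (f xs))"
proof -
  have eq: "list_drop v i = 0 \<longleftrightarrow> list_len v \<le> i" for v i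
    unfolding list_drop_def list_len_def
    by (metis drop_eq_Nil list_encode.simps(1) list_encode_inverse)
  have "recf A 1 (\<lambda>ys. LEAST i. list_drop (ys ! 0) i = 0)"
  proof (rule recf_Least)
    show "recp A (Suc 1) (\<lambda>ys. list_drop (tl ys ! 0) (hd ys) = 0)"
      by (intro recf_list_drop rec_intros) auto
  qed (auto simp: eq)
  moreover have "(LEAST i. list_len v \<le> i) = list_len v" for v
    by (rule Least_equality) auto
  ultimately have "recf A 1 (\<lambda>ys. list_len (ys ! 0))" by (simp add: eq)
  from recf_app1[OF this assms] show ?thesis .
qed

lemma recf_list_nth:
  assumes "recf A k f" "recf A k g"
  shows "recf A k (\<lambda>xs. list_nth (f xs) (g xs))"
  using assms unfolding list_nth_def by (intro recf_prod_decode recf_pred recf_list_drop)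

lemma recursive_inI:
  assumes "recp (oracle_of F) 1 (\<lambda>xs. list_decode (xs ! 0) \<in> T)"
  shows "recursive_in F T"
proof -
  obtain p where "\<And>xs. length xs = 1 \<Longrightarrow>
      orec_eval (oracle_of F) p xs (if list_decode (xs ! 0) \<in> T then 1 else 0)"
    using assms unfolding recp_def recf_def by blast
  then have "orec_eval (oracle_of F) p [list_encode s] (if s \<in> T then 1 else 0)" for s
    by (metis (no_types) list_encode_inverse length_Cons list.size(3) nth_Cons_0 One_nat_def)
  then show ?thesis
    unfolding recursive_in_def by blast
qed


section \<open>Codes of initial segments\<close>

text \<open>
  The initial segment is stored backwards. Appending an entry is then a single application of
  prod_encode, and the codes of the initial segments of a sequence form a strictly increasing
  sequence of numbers. As list_encode is a bijection, every number is the code of exactly one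
  finite sequence, whose i-th entry is entry v i.
\<close>

definition seq_code :: "(nat \<Rightarrow> nat) \<Rightarrow> nat \<Rightarrow> nat" where
  "seq_code \<phi> k = list_encode (rev (map \<phi> [0..<k]))"

definition entry :: "nat \<Rightarrow> nat \<Rightarrow> nat" where
  "entry v i = list_nth v (list_len v - Suc i)"

lemma seq_code_0: "seq_code \<phi> 0 = 0"
  and seq_code_Suc: "seq_code \<phi> (Suc k) = Suc (prod_encode (\<phi> k, seq_code \<phi> k))"
  by (simp_all add: seq_code_def)

lemma list_len_seq_code: "list_len (seq_code \<phi> k) = k"
  by (simp add: list_len_def seq_code_def)

lemma entry_eq: "i < list_len v \<Longrightarrow> entry v i = rev (list_decode v) ! i"
  unfolding entry_def by (subst list_nth_eq) (auto simp: rev_nth list_len_def)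

lemma entry_seq_code: "i < k \<Longrightarrow> entry (seq_code \<phi> k) i = \<phi> i"
  by (subst entry_eq) (simp_all add: list_len_seq_code, simp add: seq_code_def)

lemma seq_code_entry: "seq_code (entry v) (list_len v) = v"
proof -
  have "map (entry v) [0..<list_len v] = rev (list_decode v)"
    by (rule nth_equalityI) (auto simp: entry_eq, simp_all add: list_len_def)
  then show ?thesis by (simp add: seq_code_def)
qed

lemma seq_code_cong: "(\<And>i. i < k \<Longrightarrow> \<phi> i = \<psi> i) \<Longrightarrow> seq_code \<phi> k = seq_code \<psi> k"
  unfolding seq_code_def by (intro arg_cong[of _ _ "\<lambda>xs. list_encode (rev xs)"]) simp

lemma seq_code_eq_iff: "seq_code \<phi> j = seq_code \<psi> k \<longleftrightarrow> j = k \<and> (\<forall>i<k. \<phi> i = \<psi> i)"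
  by (metis seq_code_cong list_len_seq_code entry_seq_code)

lemma less_seq_code_Suc: "seq_code \<phi> k < seq_code \<phi> (Suc k)"
  using le_prod_encode_2[of "seq_code \<phi> k" "\<phi> k"] by (simp add: seq_code_Suc less_Suc_eq_le)

lemma strict_mono_seq_code: "strict_mono (seq_code \<phi>)"
  by (rule strict_mono_Suc_iff[THEN iffD2]) (simp add: less_seq_code_Suc)

lemma prod_encode_mono: "a \<le> a' \<Longrightarrow> b \<le> b' \<Longrightarrow> prod_encode (a, b) \<le> prod_encode (a', b')"
  unfolding prod_encode_def triangle_def by (simp add: add_mono div_le_mono mult_le_mono)

lemma recf_entry:
  assumes "recf A k f" "recf A k g"
  shows "recf A k (\<lambda>xs. entry (f xs) (g xs))"
  using assms unfolding entry_def by (intro recf_list_nth recf_list_len recf_diff recf_Suc)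

lemma recf_seq_code_entry:
  assumes "recf A k f" "recf A k g"
  shows "recf A k (\<lambda>xs. seq_code (entry (f xs)) (g xs))"
proof -
  have "recf A 2 (\<lambda>xs. rec_nat 0 (\<lambda>i r. Suc (prod_encode (entry (xs ! 0) i, r))) (xs ! 1))"
    by (intro recf_rec_nat recf_prod_encode recf_entry rec_intros) auto
  moreover have "rec_nat 0 (\<lambda>i r. Suc (prod_encode (entry v i, r))) n = seq_code (entry v) n" for v n
    by (induction n) (simp_all add: seq_code_0 seq_code_Suc)
  ultimately have "recf A 2 (\<lambda>xs. seq_code (entry (xs ! 0)) (xs ! 1))" by simp
  from recf_app2[OF this assms] show ?thesis .
qed


section \<open>Eventually different families\<close>

lemma eventually_different_sym: "eventually_different g h \<Longrightarrow> eventually_different h g"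
  by (simp add: eventually_different_def eq_commute)

text \<open>
  Maximality says that no function can be added, so it can be tested on single functions.
\<close>

lemma med_family_iff:
  "med_family F E \<longleftrightarrow>
     ed_family F E \<and> (\<forall>g\<in>NF F. (\<forall>h\<in>E. h \<noteq> g \<longrightarrow> eventually_different h g) \<longrightarrow> g \<in> E)"
    (is "?L \<longleftrightarrow> ?R")
proof
  assume L: ?L
  then have ed: "ed_family F E" by (simp add: med_family_def)
  have "g \<in> E" if g: "g \<in> NF F" "\<forall>h\<in>E. h \<noteq> g \<longrightarrow> eventually_different h g" for g
  proof -
    have "ed_family F (insert g E)"
      using ed g unfolding ed_family_def by (auto intro: eventually_different_sym)
    then have "insert g E = E"
      using L unfolding med_family_def by blast
    then show ?thesis by blast
  qed
  with ed show ?R by blast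
next
  assume R: ?R
  have "E' \<subseteq> E" if E': "ed_family F E'" "E \<subseteq> E'" for E'
  proof
    fix g
    assume "g \<in> E'"
    then have "g \<in> NF F" "\<forall>h\<in>E. h \<noteq> g \<longrightarrow> eventually_different h g"
      using E' by (auto simp: ed_family_def)
    then show "g \<in> E" using R by blast
  qed
  with R show ?L by (auto simp: med_family_def)
qed


section \<open>The family coded along a sequence of positions\<close>

text \<open>
  A parameter codes a pair: the function half \<phi>, which runs through all functions below F along
  the positions nn, and the place of the only odd value of \<phi>, if there is one. Parameters without an
  odd value make the set of parameters closed, as they are the limits of parameters whose odd
  value moves off to infinity.
\<close>

definition half :: "(nat \<Rightarrow> nat) \<Rightarrow> nat \<Rightarrow> nat" where
  "half \<phi> i = \<phi> i div 2"

definition params :: "(nat \<Rightarrow> enat) \<Rightarrow> (nat \<Rightarrow> nat) \<Rightarrow> (nat \<Rightarrow> nat) set" where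
  "params F nn = {\<phi>. (\<forall>k. enat (half \<phi> k) < F (nn k)) \<and> (\<forall>i j. odd (\<phi> i) \<and> odd (\<phi> j) \<longrightarrow> i = j)}"

text \<open>
  The marked positions of f are the numbers 2 * c + 1 for the codes c of the initial segments of f.
  They form an infinite set, and distinct functions have only finitely many marked positions in
  common. Even positions are never marked.
\<close>

definition marked :: "(nat \<Rightarrow> nat) \<Rightarrow> nat \<Rightarrow> bool" where
  "marked f k \<longleftrightarrow> odd k \<and> (\<exists>i. k div 2 = seq_code f i)"

lemma finite_marked_marked:
  assumes "f j \<noteq> g j"
  shows "finite {k. marked f k \<and> marked g k}"
proof (rule finite_subset)
  show "{k. marked f k \<and> marked g k} \<subseteq> (\<lambda>i. Suc (2 * seq_code f i)) ` {..j}"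
  proof
    fix k
    assume "k \<in> {k. marked f k \<and> marked g k}"
    then obtain i i' where i: "odd k" "k div 2 = seq_code f i" "k div 2 = seq_code g i'"
      by (auto simp: marked_def)
    then have "seq_code f i = seq_code g i'" by simp
    then have "\<not> j < i"
      using assms by (auto simp: seq_code_eq_iff)
    moreover have "k = Suc (2 * seq_code f i)"
      using i odd_two_times_div_two_succ[of k] by simp
    ultimately show "k \<in> (\<lambda>i. Suc (2 * seq_code f i)) ` {..j}" by auto
  qed
qed simp

lemma infinite_marked: "infinite {k. marked f k}"
proof -
  have "inj (\<lambda>i. Suc (2 * seq_code f i))"
    by (auto simp: inj_on_def seq_code_eq_iff)
  then have "infinite (range (\<lambda>i. Suc (2 * seq_code f i)))"
    by (rule range_inj_infinite)
  then show ?thesis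
    by (rule infinite_super[rotated]) (auto simp: marked_def)
qed

text \<open>
  A code is at least the length of the sequence it codes, so whether k is marked depends only on
  values of the function before k.
\<close>

lemma marked_cong:
  assumes "\<And>i. i \<le> k \<Longrightarrow> f i = g i"
  shows "marked f k \<longleftrightarrow> marked g k"
proof -
  have "i \<le> k div 2" if "k div 2 = seq_code h i" for h i
    using strict_mono_imp_increasing[OF strict_mono_seq_code, of i h] that by simp
  moreover have "seq_code f i = seq_code g i" if "i \<le> k div 2" for i
    using that assms by (intro seq_code_cong) auto
  ultimately show ?thesis
    unfolding marked_def by metis
qed

text \<open>
  Closedness of the set of parameters: longer and longer agreement makes the sequence \<psi> converge, and
  each condition on a parameter concerns at most two of its values.
\<close>

lemma params_limit:
  assumes \<psi>: "\<And>i. \<psi> i \<in> params F nn"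
    and agree: "\<And>i j l. i \<le> j \<Longrightarrow> l < t i \<Longrightarrow> \<psi> i l = \<psi> j l"
    and t: "\<And>i. i < t i"
  obtains \<xi> where "\<xi> \<in> params F nn" "\<And>i l. l < t i \<Longrightarrow> \<psi> i l = \<xi> l"
proof
  define \<xi> where "\<xi> l = \<psi> l l" for l
  show agr: "\<psi> i l = \<xi> l" if "l < t i" for i l
    using agree[of i l l] agree[of l i l] that t[of l] unfolding \<xi>_def
    by (cases "i \<le> l") auto
  show "\<xi> \<in> params F nn"
  proof -
    have "half \<xi> k = half (\<psi> k) k" for k
      by (simp add: half_def \<xi>_def)
    moreover have "i = j" if "odd (\<xi> i)" "odd (\<xi> j)" for i j
    proof -
      have "i < t (max i j)" "j < t (max i j)"
        using t[of "max i j"] by auto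
      then have "odd (\<psi> (max i j) i)" "odd (\<psi> (max i j) j)"
        using that by (simp_all add: agr)
      then show ?thesis
        using \<psi>[of "max i j"] by (auto simp: params_def)
    qed
    ultimately show ?thesis
      using \<psi> by (auto simp: params_def)
  qed
qed

text \<open>
  The parameters are functions of the index k, and nn k is the position at which a member of the
  family may copy the k-th value of half \<phi>. Where it copies nothing, a member codes at n the first
  m n values of its parameter, which fits below F n by the last assumption.
\<close>

locale coding_frame =
  fixes F :: "nat \<Rightarrow> enat" and nn m :: "nat \<Rightarrow> nat"
  assumes F_pos: "\<And>n. F n \<noteq> 0"
    and F_unbounded: "\<And>b. finite {n. F n \<le> enat b}"
    and nn_mono: "strict_mono nn"
    and m_nn: "\<And>k. m (nn k) = k"
    and m_unbounded: "\<And>b. finite {n. m n \<le> b}"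
    and code_less: "\<And>\<phi> n. \<phi> \<in> params F nn \<Longrightarrow> enat (seq_code \<phi> (m n)) < F n"
begin

abbreviation "P \<equiv> params F nn"

text \<open>
  Read f j and f k as codes of initial segments of lengths j and k. The marked positions of f,
  ordered by "f k codes an extension of what f j codes", form a forest, and the extra root 0 (never
  marked, since it is even) turns it into a tree. Only codes of initial segments of
  parameters count. The parent of k is its immediate predecessor in this tree.
\<close>

definition below :: "(nat \<Rightarrow> nat) \<Rightarrow> nat \<Rightarrow> nat \<Rightarrow> bool" where
  "below f j k \<longleftrightarrow> j < k \<and> marked f j \<and> (\<exists>\<psi>\<in>P. f j = seq_code \<psi> j \<and> f k = seq_code \<psi> k)"

definition parent :: "(nat \<Rightarrow> nat) \<Rightarrow> nat \<Rightarrow> nat \<Rightarrow> bool" where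
  "parent f q k \<longleftrightarrow> q < k \<and> (q = 0 \<or> below f q k) \<and> (\<forall>r<k. q < r \<longrightarrow> \<not> below f r k)"

text \<open>
  The member with parameter \<phi> copies half \<phi> at those marked positions whose parent is the place q of the
  odd value of \<phi>. These are the children of one node and hence pairwise incomparable, so half \<phi>
  agrees there with any one coding sequence at most once.
\<close>

definition copies :: "(nat \<Rightarrow> nat) \<Rightarrow> nat \<Rightarrow> bool" where
  "copies \<phi> k \<longleftrightarrow> marked (half \<phi>) k \<and> (\<exists>q<k. odd (\<phi> q) \<and> parent (half \<phi>) q k)"

definition val :: "(nat \<Rightarrow> nat) \<Rightarrow> nat \<Rightarrow> nat" where
  "val \<phi> n = (if nn (m n) = n \<and> copies \<phi> (m n) then half \<phi> (m n) else seq_code \<phi> (m n))"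

definition family :: "(nat \<Rightarrow> nat) set" where
  "family = val ` P"

lemma inj_nn: "inj nn"
  using nn_mono by (rule strict_mono_imp_inj_on)

lemma val_in_NF: "\<phi> \<in> P \<Longrightarrow> val \<phi> \<in> NF F"
  unfolding NF_def val_def using code_less by (auto simp: params_def) metis

lemma parent_unique: "parent f q k \<Longrightarrow> parent f r k \<Longrightarrow> q = r"
  unfolding parent_def by (metis gr0I linorder_neqE_nat not_less0)

lemma parent_exists:
  assumes "0 < k"
  shows "\<exists>q. parent f q k"
proof -
  define S where "S = {0} \<union> {q. below f q k}"
  have S: "S \<subseteq> {..<k}"
    using assms by (auto simp: S_def below_def)
  then have fin: "finite S"
    using finite_subset by blast
  have "Max S \<in> S"
    using fin by (intro Max_in) (auto simp: S_def)
  moreover have "\<not> below f r k" if "Max S < r" for r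
    using Max_ge[OF fin, of r] that by (auto simp: S_def)
  moreover have "Max S < k" "Max S = 0 \<or> below f (Max S) k"
    using \<open>Max S \<in> S\<close> S unfolding S_def by blast+
  ultimately have "parent f (Max S) k"
    unfolding parent_def by blast
  then show ?thesis ..
qed

lemma below_trans:
  assumes "below f i j" "below f j k"
  shows "below f i k"
proof -
  obtain \<psi> where \<psi>: "f i = seq_code \<psi> i" "f j = seq_code \<psi> j"
    using assms(1) by (auto simp: below_def)
  obtain \<xi> where \<xi>: "\<xi> \<in> P" "f j = seq_code \<xi> j" "f k = seq_code \<xi> k"
    using assms(2) by (auto simp: below_def)
  have "f i = seq_code \<xi> i"
    using \<psi> \<xi> assms(1) by (auto simp: seq_code_eq_iff below_def)
  with \<xi> assms show ?thesis
    by (auto simp: below_def)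
qed

lemma below_linear:
  assumes "below f i k" "below f j k" "i < j"
  shows "below f i j"
proof -
  obtain \<psi> where \<psi>: "f i = seq_code \<psi> i" "f k = seq_code \<psi> k"
    using assms(1) by (auto simp: below_def)
  obtain \<xi> where \<xi>: "\<xi> \<in> P" "f j = seq_code \<xi> j" "f k = seq_code \<xi> k"
    using assms(2) by (auto simp: below_def)
  have "f i = seq_code \<xi> i"
    using \<psi> \<xi> assms(1) by (auto simp: seq_code_eq_iff below_def)
  with \<xi> assms show ?thesis
    by (auto simp: below_def)
qed

text \<open>
  Two such agreements at k < l would make k a predecessor of l in the tree that comes after the
  common parent of k and l, contrary to the parent being the last predecessor.
\<close>

lemma copies_meets_code_once:
  assumes \<phi>: "\<phi> \<in> P" and \<psi>: "\<psi> \<in> P"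
    and k: "copies \<phi> k" "half \<phi> k = seq_code \<psi> k"
    and l: "copies \<phi> l" "half \<phi> l = seq_code \<psi> l"
  shows "k = l"
proof -
  have False
    if ij: "i < j" "copies \<phi> i" "copies \<phi> j" "half \<phi> i = seq_code \<psi> i" "half \<phi> j = seq_code \<psi> j"
    for i j
  proof -
    obtain q where q: "q < i" "odd (\<phi> q)"
      using ij(2) by (auto simp: copies_def)
    obtain r where r: "odd (\<phi> r)" "parent (half \<phi>) r j"
      using ij(3) by (auto simp: copies_def)
    have "q = r"
      using \<phi> q r by (auto simp: params_def)
    moreover have "below (half \<phi>) i j"
      using ij \<psi> by (auto simp: below_def copies_def)
    ultimately show False
      using q r(2) ij(1) by (auto simp: parent_def)
  qed
  with k l show ?thesis
    by (metis linorder_neqE_nat)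
qed

text \<open>
  Codes of distinct sequences differ from some length on, and a copied value meets a given coding
  sequence at most once. Two members both copy infinitely often only if half \<phi> = half \<psi>; then the
  common positions have a common parent, which is the place of the odd value of both parameters,
  and the parameters are equal.
\<close>

lemma val_eventually_different:
  assumes \<phi>: "\<phi> \<in> P" and \<psi>: "\<psi> \<in> P" and "\<phi> \<noteq> \<psi>"
  shows "eventually_different (val \<phi>) (val \<psi>)"
proof -
  obtain j where j: "\<phi> j \<noteq> \<psi> j"
    using \<open>\<phi> \<noteq> \<psi>\<close> by blast
  define S where "S \<alpha> \<beta> = {k. copies \<alpha> k \<and> half \<alpha> k = seq_code \<beta> k}" for \<alpha> \<beta>
  have finS: "finite (S \<alpha> \<beta>)" if "\<alpha> \<in> P" "\<beta> \<in> P" for \<alpha> \<beta>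
  proof (cases "S \<alpha> \<beta> = {}")
    case False
    then obtain k where "k \<in> S \<alpha> \<beta>" by blast
    then have "S \<alpha> \<beta> \<subseteq> {k}"
      using copies_meets_code_once[OF that] by (auto simp: S_def)
    then show ?thesis
      using finite_subset by blast
  qed simp
  have "finite {k. copies \<phi> k \<and> copies \<psi> k}"
  proof (cases "half \<phi> = half \<psi>")
    case True
    have False if k: "copies \<phi> k" "copies \<psi> k" for k
    proof -
      obtain q where q: "odd (\<phi> q)" "odd (\<psi> q)"
        using k True parent_unique by (metis copies_def)
      have "\<phi> i = \<psi> i" for i
      proof -
        have "odd (\<phi> i) \<longleftrightarrow> i = q" "odd (\<psi> i) \<longleftrightarrow> i = q"
          using \<phi> \<psi> q unfolding params_def by blast+
        moreover have "\<phi> i div 2 = \<psi> i div 2"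
          using True by (metis half_def)
        ultimately show ?thesis
          by (metis bit_eq_rec)
      qed
      with \<open>\<phi> \<noteq> \<psi>\<close> show False by blast
    qed
    then show ?thesis
      by (metis (no_types, lifting) Collect_empty_eq finite.emptyI)
  next
    case False
    then obtain i where "half \<phi> i \<noteq> half \<psi> i" by blast
    then have "finite {k. marked (half \<phi>) k \<and> marked (half \<psi>) k}"
      by (rule finite_marked_marked)
    then show ?thesis
      by (rule finite_subset[rotated]) (auto simp: copies_def)
  qed
  then have fin: "finite ({n. m n \<le> j} \<union> nn ` (S \<phi> \<psi> \<union> S \<psi> \<phi> \<union> {k. copies \<phi> k \<and> copies \<psi> k}))"
    using finS[OF \<phi> \<psi>] finS[OF \<psi> \<phi>] m_unbounded by simp
  have "{n. val \<phi> n = val \<psi> n} \<subseteq>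
      {n. m n \<le> j} \<union> nn ` (S \<phi> \<psi> \<union> S \<psi> \<phi> \<union> {k. copies \<phi> k \<and> copies \<psi> k})"
  proof
    fix n
    assume "n \<in> {n. val \<phi> n = val \<psi> n}"
    then have eq: "val \<phi> n = val \<psi> n" by simp
    have seq: "seq_code \<phi> (m n) = seq_code \<psi> (m n) \<Longrightarrow> m n \<le> j"
      using j by (auto simp: seq_code_eq_iff not_less[symmetric])
    show "n \<in> {n. m n \<le> j} \<union> nn ` (S \<phi> \<psi> \<union> S \<psi> \<phi> \<union> {k. copies \<phi> k \<and> copies \<psi> k})"
    proof (cases "m n \<le> j")
      case False
      have "nn (m n) = n \<and> m n \<in> S \<phi> \<psi> \<union> S \<psi> \<phi> \<union> {k. copies \<phi> k \<and> copies \<psi> k}"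
        using eq seq False unfolding val_def S_def
        by (auto split: if_splits)
      then show ?thesis by (metis UnI2 imageI)
    qed simp
  qed
  then show ?thesis
    unfolding eventually_different_def using fin finite_subset by blast
qed

text \<open>
  This is Koenig's lemma: an infinite, finitely branching tree has an infinite branch. The codes
  along that branch are codes of longer and longer initial segments of a single parameter.
\<close>

lemma finite_children_imp_infinite_branch:
  assumes fin: "\<And>q. finite {k. marked f k \<and> parent f q k}"
  obtains \<psi> where "\<psi> \<in> P" "infinite {k. marked f k \<and> f k = seq_code \<psi> k}"
proof -
  define desc where "desc q = {k. marked f k \<and> (q = 0 \<or> q = k \<or> below f q k)}" for q
  \<comment> \<open>Every proper descendant of q is a descendant of a child of q: go up from k until the parent is q.\<close>
  have child: "\<exists>q'. marked f q' \<and> parent f q q' \<and> k \<in> desc q'" if "k \<in> desc q" "k \<noteq> q" for k q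
    using that
  proof (induction k rule: less_induct)
    case (less k)
    have mk: "marked f k"
      using less.prems by (simp add: desc_def)
    then have "0 < k"
      by (auto simp: marked_def intro: gr0I)
    then obtain p where p: "parent f p k"
      using parent_exists by blast
    show ?case
    proof (cases "p = q")
      case True
      with p mk show ?thesis by (intro exI[of _ k]) (auto simp: desc_def)
    next
      case False
      have qk: "q = 0 \<or> below f q k"
        using less.prems by (auto simp: desc_def)
      then have "q < p"
        using p False by (auto simp: parent_def below_def)
      then have pk: "below f p k"
        using p by (auto simp: parent_def)
      have "p \<in> desc q"
        using qk pk \<open>q < p\<close> below_linear[of f q k p] by (auto simp: desc_def below_def)
      then obtain q' where q': "marked f q'" "parent f q q'" "p \<in> desc q'"
        using less.IH[of p] \<open>q < p\<close> pk by (auto simp: below_def)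
      have "q' = p \<or> below f q' p"
        using q' by (auto simp: desc_def parent_def)
      then have "k \<in> desc q'"
        using below_trans pk mk by (auto simp: desc_def)
      with q' show ?thesis by blast
    qed
  qed
  have step: "\<exists>q'. infinite (desc q') \<and> marked f q' \<and> parent f q q'" if "infinite (desc q)" for q
  proof (rule ccontr)
    assume "\<not> ?thesis"
    then have "finite (insert q (\<Union>q'\<in>{k. marked f k \<and> parent f q k}. desc q'))"
      using fin by auto
    moreover have "desc q \<subseteq> insert q (\<Union>q'\<in>{k. marked f k \<and> parent f q k}. desc q')"
      using child by blast
    ultimately show False
      using that finite_subset by blast
  qed
  have "infinite (desc 0)"
    using infinite_marked[of f] by (simp add: desc_def)
  then obtain s :: "nat \<Rightarrow> nat" where "\<forall>i. infinite (desc (s i)) \<and> marked f (s (Suc i)) \<and> parent f (s i) (s (Suc i))"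
    using dependent_nat_choice[of "\<lambda>_ q. infinite (desc q)" "\<lambda>_ q q'. marked f q' \<and> parent f q q'"] step
    by metis
  then have s: "marked f (s (Suc i))" "parent f (s i) (s (Suc i))" for i
    by auto
  \<comment> \<open>The branch starts at the root 0, which is not marked and carries no code; it is skipped.\<close>
  define t where "t i = s (Suc i)" for i
  have t_pos: "0 < t i" for i
    using s(1)[of i] by (auto simp: t_def marked_def intro: gr0I)
  have "below f (t i) (t (Suc i))" for i
    using s(2)[of "Suc i"] t_pos[of i] by (auto simp: t_def parent_def)
  then obtain \<psi> where \<psi>: "\<And>i. \<psi> i \<in> P" "\<And>i. f (t i) = seq_code (\<psi> i) (t i)"
      "\<And>i. f (t (Suc i)) = seq_code (\<psi> i) (t (Suc i))"
    unfolding below_def by metis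
  have t_mono: "strict_mono t"
    using s(2)[of "Suc _"] by (simp add: strict_mono_Suc_iff t_def parent_def)
  have agree: "\<psi> i l = \<psi> j l" if "i \<le> j" "l < t (Suc i)" for i j l
    using that
  proof (induction j rule: dec_induct)
    case (step j)
    have "l < t (Suc j)"
      using step t_mono by (meson Suc_le_mono less_le_trans strict_mono_less_eq)
    moreover have "seq_code (\<psi> j) (t (Suc j)) = seq_code (\<psi> (Suc j)) (t (Suc j))"
      using \<psi>(2,3) by metis
    ultimately show ?case
      using step by (simp add: seq_code_eq_iff)
  qed simp
  have "i < t (Suc i)" for i
    using strict_mono_imp_increasing[OF t_mono, of "Suc i"] by simp
  from params_limit[of \<psi> F nn "\<lambda>i. t (Suc i)", OF \<psi>(1) agree this]
  obtain \<xi> where \<xi>: "\<xi> \<in> P" "\<And>i l. l < t (Suc i) \<Longrightarrow> \<psi> i l = \<xi> l"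
    by blast
  have "f (t i) = seq_code \<xi> (t i)" for i
  proof -
    have "t i < t (Suc i)"
      using t_mono by (simp add: strict_mono_Suc_iff)
    then have "seq_code (\<psi> i) (t i) = seq_code \<xi> (t i)"
      using \<xi>(2) by (intro seq_code_cong) auto
    then show ?thesis
      using \<psi>(2) by simp
  qed
  then have "range t \<subseteq> {k. marked f k \<and> f k = seq_code \<xi> k}"
    using s(1) by (auto simp: t_def)
  moreover have "infinite (range t)"
    using t_mono strict_mono_imp_inj_on range_inj_infinite by blast
  ultimately have "infinite {k. marked f k \<and> f k = seq_code \<xi> k}"
    using infinite_super by blast
  with \<xi>(1) show ?thesis by (rule that)
qed

text \<open>
  The reason for maximality. Let f be the restriction of g to the coding positions. If some node q
  of the tree of f has infinitely many children, the member whose parameter codes the pair of f and q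
  copies f there. Otherwise some parameter \<psi> has codes that agree with f at infinitely many marked
  positions of f. The member val \<psi> keeps these codes except where it copies; if half \<psi> \<noteq> f it does so
  at only finitely many of these positions, and if half \<psi> = f a copied value is again a value of f.
\<close>

lemma val_meets:
  assumes g: "g \<in> NF F"
  shows "\<exists>\<phi>\<in>P. infinite {n. val \<phi> n = g n}"
proof -
  define f where "f k = g (nn k)" for k
  have meets: "infinite {n. val \<phi> n = g n}" if "infinite K" "\<And>k. k \<in> K \<Longrightarrow> val \<phi> (nn k) = f k" for \<phi> K
  proof -
    have "infinite (nn ` K)"
      using that(1) finite_imageD inj_nn by (metis inj_on_subset subset_UNIV)
    moreover have "nn ` K \<subseteq> {n. val \<phi> n = g n}"
      using that(2) by (auto simp: f_def)
    ultimately show ?thesis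
      using infinite_super by blast
  qed
  show ?thesis
  proof (cases "\<exists>q. infinite {k. marked f k \<and> parent f q k}")
    case True
    then obtain q where q: "infinite {k. marked f k \<and> parent f q k}" by blast
    define \<phi> where "\<phi> i = 2 * f i + (if i = q then 1 else 0)" for i
    have half: "half \<phi> = f"
      by (auto simp: half_def \<phi>_def)
    have "\<phi> \<in> P"
      using g by (auto simp: params_def half f_def NF_def) (auto simp: \<phi>_def split: if_splits)
    moreover have "val \<phi> (nn k) = f k" if "marked f k" "parent f q k" for k
    proof -
      have "copies \<phi> k"
        unfolding copies_def half using that by (auto simp: parent_def \<phi>_def)
      then show ?thesis
        by (simp add: val_def m_nn half)
    qed
    ultimately show ?thesis
      using meets[OF q] by blast
  next
    case False
    then obtain \<psi> where \<psi>: "\<psi> \<in> P" and inf: "infinite {k. marked f k \<and> f k = seq_code \<psi> k}"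
      using finite_children_imp_infinite_branch[of f] by blast
    let ?Y = "{k. marked f k \<and> f k = seq_code \<psi> k}"
    show ?thesis
    proof (cases "half \<psi> = f")
      case True
      have "val \<psi> (nn k) = f k" if "k \<in> ?Y" for k
        using that True by (auto simp: val_def m_nn)
      then show ?thesis
        using meets[OF inf] \<psi> by blast
    next
      case False
      then obtain i where "half \<psi> i \<noteq> f i" by blast
      then have "finite {k. marked (half \<psi>) k \<and> marked f k}"
        by (rule finite_marked_marked)
      then have "infinite (?Y - {k. marked (half \<psi>) k \<and> marked f k})"
        using inf by (rule Diff_infinite_finite)
      moreover have "val \<psi> (nn k) = f k" if "k \<in> ?Y - {k. marked (half \<psi>) k \<and> marked f k}" for k
        using that by (auto simp: val_def m_nn copies_def)
      ultimately show ?thesis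
        using meets \<psi> by blast
    qed
  qed
qed

lemma med_family_family: "med_family F family"
  unfolding med_family_iff
proof (intro conjI ballI impI)
  show "ed_family F family"
    unfolding ed_family_def family_def
    using val_in_NF val_eventually_different by blast
next
  fix g
  assume g: "g \<in> NF F" and ed: "\<forall>h\<in>family. h \<noteq> g \<longrightarrow> eventually_different h g"
  obtain \<phi> where "\<phi> \<in> P" "infinite {n. val \<phi> n = g n}"
    using val_meets[OF g] by blast
  moreover from this have "val \<phi> = g"
    using ed unfolding eventually_different_def family_def by blast
  ultimately show "g \<in> family"
    by (auto simp: family_def)
qed

end


section \<open>The topology of the space\<close>

text \<open>
  Fixing the values of g at finitely many places gives a basis of the topology.
\<close>

lemma openin_cylinder: "openin (NF_topology F) {g \<in> NF F. \<forall>i<n. g i = h i}"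
proof -
  let ?S = "\<lambda>i. if i < n then {k. enat k < F i} \<inter> {h i} else {k. enat k < F i}"
  have "g i \<in> ?S i \<longleftrightarrow> enat (g i) < F i \<and> (i < n \<longrightarrow> g i = h i)" for g i
    by auto
  then have "{g \<in> NF F. \<forall>i<n. g i = h i} = PiE UNIV ?S"
    unfolding NF_def PiE_iff set_eq_iff mem_Collect_eq extensional_UNIV by blast
  moreover have "finite {i \<in> UNIV. ?S i \<noteq> {k. enat k < F i}}"
    by (rule finite_subset[of _ "{..<n}"]) auto
  ultimately show ?thesis
    unfolding NF_topology_def by (simp only: openin_PiE_gen) auto
qed

lemma openin_contains_cylinder:
  assumes "openin (NF_topology F) U" "h \<in> U"
  obtains n where "\<And>g. g \<in> NF F \<Longrightarrow> (\<forall>i<n. g i = h i) \<Longrightarrow> g \<in> U"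
proof -
  obtain V where fin: "finite {i. V i \<noteq> {k. enat k < F i}}"
    and h: "h \<in> PiE UNIV V" and sub: "PiE UNIV V \<subseteq> U"
    using assms unfolding NF_topology_def openin_product_topology_alt by auto
  obtain n where n: "\<And>i. V i \<noteq> {k. enat k < F i} \<Longrightarrow> i < n"
    using fin by (auto simp: finite_nat_set_iff_bounded)
  have "g \<in> U" if "g \<in> NF F" "\<forall>i<n. g i = h i" for g
  proof -
    have "g i \<in> V i" for i
      using that h n[of i] by (cases "i < n") (auto simp: NF_def PiE_iff)
    then show ?thesis using sub by (auto simp: PiE_iff)
  qed
  then show ?thesis by (rule that)
qed

lemma closedin_branches:
  assumes "branches T \<subseteq> NF F"
  shows "closedin (NF_topology F) (branches T)"
  unfolding closedin_def topspace_NF_topology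
proof (intro conjI assms)
  show "openin (NF_topology F) (NF F - branches T)"
    unfolding openin_subopen[of _ "NF F - branches T"]
  proof
    fix h
    assume h: "h \<in> NF F - branches T"
    then obtain n where n: "map h [0..<n] \<notin> T"
      by (auto simp: branches_def)
    let ?U = "{g \<in> NF F. \<forall>i<n. g i = h i}"
    have "?U \<subseteq> NF F - branches T"
    proof
      fix g
      assume g: "g \<in> ?U"
      then have "map g [0..<n] = map h [0..<n]" by simp
      then have "map g [0..<n] \<notin> T"
        using n by (simp only: not_False_eq_True)
      then have "g \<notin> branches T"
        unfolding branches_def by blast
      then show "g \<in> NF F - branches T"
        using g by blast
    qed
    with h show "\<exists>U. openin (NF_topology F) U \<and> h \<in> U \<and> U \<subseteq> NF F - branches T"
      by (intro exI[of _ ?U] conjI openin_cylinder) auto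
  qed
qed

lemma compactin_bounded:
  assumes "closedin (NF_topology F) E" "\<And>g n. g \<in> E \<Longrightarrow> g n \<le> b n"
  shows "compactin (NF_topology F) E"
proof (rule closed_compactin)
  let ?K = "PiE UNIV (\<lambda>n. {k. enat k < F n} \<inter> {..b n})"
  show "compactin (NF_topology F) ?K"
    unfolding NF_topology_def compactin_PiE by (auto simp: compactin_discrete_topology)
  show "E \<subseteq> ?K"
    using assms closedin_subset[OF assms(1)]
    by (auto simp: topspace_NF_topology NF_def PiE_iff)
qed (fact assms)


section \<open>The family is perfect and effectively closed\<close>

context coding_frame
begin

lemma copies_cong:
  assumes "\<And>i. i \<le> k \<Longrightarrow> \<phi> i = \<psi> i"
  shows "copies \<phi> k \<longleftrightarrow> copies \<psi> k"
proof -
  have h: "half \<phi> i = half \<psi> i" if "i \<le> k" for i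
    using assms that by (simp add: half_def)
  have mk: "marked (half \<phi>) i \<longleftrightarrow> marked (half \<psi>) i" if "i \<le> k" for i
    using h that by (intro marked_cong) auto
  have bl: "below (half \<phi>) q k \<longleftrightarrow> below (half \<psi>) q k" for q
    using h mk[of q] by (cases "q < k") (auto simp: below_def)
  have "parent (half \<phi>) q k \<longleftrightarrow> parent (half \<psi>) q k" for q
    by (simp add: parent_def bl)
  then show ?thesis
    using assms mk[of k] by (auto simp: copies_def)
qed

lemma val_cong:
  assumes "\<And>i. i \<le> m n \<Longrightarrow> \<phi> i = \<psi> i"
  shows "val \<phi> n = val \<psi> n"
proof -
  have "copies \<phi> (m n) \<longleftrightarrow> copies \<psi> (m n)" "half \<phi> (m n) = half \<psi> (m n)"
    "seq_code \<phi> (m n) = seq_code \<psi> (m n)"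
    using assms by (auto intro!: copies_cong seq_code_cong simp: half_def)
  then show ?thesis by (simp add: val_def)
qed

definition valid_code :: "nat \<Rightarrow> nat \<Rightarrow> bool" where
  "valid_code v k \<longleftrightarrow> (\<exists>\<psi>\<in>P. v = seq_code \<psi> k)"

text \<open>
  Even indices are never copied, so a member shows the code of an initial segment of its parameter
  at every position nn k with k even. That code determines the values of the member at all n with
  m n < k, and a finite sequence is in the tree if it passes all these tests.
\<close>

definition tree :: "nat list set" where
  "tree = {s. \<forall>x<length s. nn (m x) = x \<and> even (m x) \<longrightarrow>
     valid_code (s ! x) (m x) \<and>
     (\<forall>n<length s. m n < m x \<longrightarrow> s ! n = val (entry (s ! x)) n)}"

lemma is_tree_tree: "is_tree tree"
  unfolding is_tree_def
proof (intro ballI allI impI)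
  fix t s
  assume t: "t \<in> tree" and "prefix s t"
  then obtain u where u: "t = s @ u"
    by (auto simp: prefix_def)
  have "s ! x = t ! x" "x < length t" if "x < length s" for x
    using that by (simp_all add: u nth_append)
  with t show "s \<in> tree"
    by (simp add: tree_def)
qed

text \<open>
  The codes that a branch shows at the positions of even index extend each other, because the test
  at one such position covers the earlier ones. Their limit is the parameter of the branch.
\<close>

lemma branches_tree: "branches tree = family"
proof (intro equalityI subsetI)
  fix h
  assume "h \<in> family"
  then obtain \<phi> where \<phi>: "\<phi> \<in> P" and h: "h = val \<phi>"
    by (auto simp: family_def)
  have "map h [0..<N] \<in> tree" for N
  proof -
    have "valid_code (h x) (m x)" "m n < m x \<Longrightarrow> h n = val (entry (h x)) n"
      if "even (m x)" for x n
    proof -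
      have hx: "h x = seq_code \<phi> (m x)"
        using that by (simp add: h val_def copies_def marked_def)
      show "valid_code (h x) (m x)"
        using \<phi> by (auto simp: valid_code_def hx)
      show "h n = val (entry (h x)) n" if "m n < m x"
        unfolding hx unfolding h using that by (intro val_cong) (simp add: entry_seq_code)
    qed
    then show ?thesis by (simp add: tree_def)
  qed
  then show "h \<in> branches tree"
    by (simp add: branches_def)
next
  fix h
  assume h: "h \<in> branches tree"
  have code: "valid_code (h (nn (2 * k))) (2 * k)"
    "\<And>n. m n < 2 * k \<Longrightarrow> h n = val (entry (h (nn (2 * k)))) n" for k
  proof -
    have tr: "valid_code (h (nn (2 * k))) (2 * k) \<and>
        (\<forall>n<N. m n < 2 * k \<longrightarrow> h n = val (entry (h (nn (2 * k)))) n)"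
      if N: "nn (2 * k) < N" for N
    proof -
      have "map h [0..<N] \<in> tree"
        using h by (simp add: branches_def)
      then have "\<forall>x<N. nn (m x) = x \<and> even (m x) \<longrightarrow> valid_code (h x) (m x) \<and>
          (\<forall>n<N. m n < m x \<longrightarrow> h n = val (entry (h x)) n)"
        by (simp add: tree_def)
      from this[rule_format, OF N] show ?thesis
        by (simp add: m_nn)
    qed
    show "valid_code (h (nn (2 * k))) (2 * k)"
      using tr[of "Suc (nn (2 * k))"] by simp
    show "h n = val (entry (h (nn (2 * k)))) n" if "m n < 2 * k" for n
      using tr[of "Suc (max n (nn (2 * k)))"] that by simp
  qed
  then obtain \<psi> where \<psi>: "\<And>k. \<psi> k \<in> P" "\<And>k. h (nn (2 * k)) = seq_code (\<psi> k) (2 * k)"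
    unfolding valid_code_def by metis
  have hval: "h n = val (\<psi> k) n" if "m n < 2 * k" for n k
  proof -
    have "h n = val (entry (h (nn (2 * k)))) n"
      by (rule code(2)[OF that])
    also have "\<dots> = val (\<psi> k) n"
      unfolding \<psi>(2) using that by (intro val_cong) (simp add: entry_seq_code)
    finally show ?thesis .
  qed
  have agree: "\<psi> i l = \<psi> j l" if "i \<le> j" "l < 2 * i" for i j l
  proof (cases "i = j")
    case False
    have "seq_code (\<psi> i) (2 * i) = val (\<psi> j) (nn (2 * i))"
      using hval[of "nn (2 * i)" j] False that by (simp add: m_nn \<psi>(2))
    also have "\<dots> = seq_code (\<psi> j) (2 * i)"
      by (simp add: val_def m_nn copies_def marked_def)
    finally show ?thesis
      using that by (simp add: seq_code_eq_iff)
  qed simp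
  have "\<psi> (Suc i) l = \<psi> (Suc j) l" if "i \<le> j" "l < 2 * Suc i" for i j l
    using agree[of "Suc i" "Suc j" l] that by simp
  from params_limit[of "\<lambda>i. \<psi> (Suc i)" F nn "\<lambda>i. 2 * Suc i", OF \<psi>(1) this]
  obtain \<xi> where \<xi>: "\<xi> \<in> P" "\<And>i l. l < 2 * Suc i \<Longrightarrow> \<psi> (Suc i) l = \<xi> l"
    by auto
  have "h n = val \<xi> n" for n
  proof -
    have "h n = val (\<psi> (Suc (m n))) n"
      by (rule hval) simp
    also have "\<dots> = val \<xi> n"
      by (intro val_cong \<xi>(2)) simp
    finally show ?thesis .
  qed
  then have "h = val \<xi>" by blast
  with \<xi>(1) show "h \<in> family"
    by (simp add: family_def)
qed

lemma family_subset_NF: "family \<subseteq> NF F"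
  using val_in_NF by (auto simp: family_def)

lemma closedin_family: "closedin (NF_topology F) family"
  using closedin_branches[of tree F] family_subset_NF by (simp add: branches_tree)

lemma params_nonempty: "(\<lambda>_. 0) \<in> P"
  using F_pos by (simp add: params_def half_def enat_0 zero_less_iff_neq_zero)

text \<open>
  Far out F exceeds 1 along nn, so a value of the parameter can be changed there without changing
  its parity; this affects only positions n with large m n.
\<close>

lemma params_not_isolated:
  assumes \<phi>: "\<phi> \<in> P"
  shows "\<exists>\<psi>\<in>P. \<psi> \<noteq> \<phi> \<and> (\<forall>n<N. val \<psi> n = val \<phi> n)"
proof -
  obtain b where b: "\<And>n. n < N \<Longrightarrow> m n \<le> b"
    by (metis Max_ge finite_imageI finite_lessThan imageI lessThan_iff)
  have "finite (nn -` {n. F n \<le> enat 1})"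
    using F_unbounded inj_nn by (intro finite_vimageI)
  then have "finite (nn -` {n. F n \<le> enat 1} \<union> {..b})"
    by simp
  then obtain k where k: "k \<notin> nn -` {n. F n \<le> enat 1} \<union> {..b}"
    using ex_new_if_finite infinite_UNIV_nat by blast
  define \<psi> where "\<psi> = \<phi>(k := if half \<phi> k = 0 then \<phi> k + 2 else \<phi> k mod 2)"
  have par: "odd (\<psi> i) \<longleftrightarrow> odd (\<phi> i)" for i
    by (auto simp: \<psi>_def)
  have "enat (half \<psi> i) < F (nn i)" for i
  proof (cases "i = k")
    case True
    have "half \<psi> k \<le> 1"
      by (auto simp: half_def \<psi>_def)
    then have "enat (half \<psi> k) \<le> enat 1" by simp
    also have "\<dots> < F (nn k)" using k by (simp add: not_le)
    finally show ?thesis using True by simp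
  next
    case False
    then show ?thesis using \<phi> by (auto simp: half_def \<psi>_def params_def)
  qed
  then have "\<psi> \<in> P"
    using \<phi> unfolding params_def by (simp add: par)
  moreover have "\<psi> k \<noteq> \<phi> k"
    by (auto simp: \<psi>_def half_def)
  then have "\<psi> \<noteq> \<phi>" by auto
  moreover have "val \<psi> n = val \<phi> n" if "n < N" for n
    using b[OF that] k by (intro val_cong) (auto simp: \<psi>_def)
  ultimately show ?thesis by blast
qed

lemma perfect_family: "perfect_in (NF_topology F) family"
  unfolding perfect_in_def
proof (intro conjI ballI notI closedin_family)
  show "family = {} \<Longrightarrow> False"
    using params_nonempty by (auto simp: family_def)
next
  fix h
  assume "h \<in> family" "\<exists>U. openin (NF_topology F) U \<and> U \<inter> family = {h}"
  then obtain \<phi> U where \<phi>: "\<phi> \<in> P" "h = val \<phi>"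
    and U: "openin (NF_topology F) U" "U \<inter> family = {h}"
    by (auto simp: family_def)
  obtain N where N: "\<And>g. g \<in> NF F \<Longrightarrow> (\<forall>i<N. g i = h i) \<Longrightarrow> g \<in> U"
    using openin_contains_cylinder[OF U(1)] U(2) by blast
  obtain \<psi> where \<psi>: "\<psi> \<in> P" "\<psi> \<noteq> \<phi>" "\<forall>n<N. val \<psi> n = val \<phi> n"
    using params_not_isolated[OF \<phi>(1)] by blast
  have "val \<psi> \<in> U \<inter> family"
    using N[OF val_in_NF[OF \<psi>(1)]] \<psi> \<phi> by (simp add: family_def)
  then have "val \<psi> = val \<phi>"
    using U(2) \<phi>(2) by blast
  then show False
    using val_eventually_different[OF \<psi>(1) \<phi>(1) \<psi>(2)] by (simp add: eventually_different_def)
qed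

end

lemma less_oracle_of: "enat x < F n \<longleftrightarrow> oracle_of F n = 0 \<or> Suc x < oracle_of F n"
  by (auto simp: oracle_of_def split: enat.splits)

lemma recp_less_F:
  assumes "recf (oracle_of F) k f" "recf (oracle_of F) k g"
  shows "recp (oracle_of F) k (\<lambda>xs. enat (f xs) < F (g xs))"
  unfolding less_oracle_of using assms by (intro rec_intros)

lemma eq_seq_code_iff:
  "v = seq_code f k \<longleftrightarrow> list_len v = k \<and> (\<forall>i<k. entry v i = f i)"
  by (metis seq_code_entry seq_code_eq_iff)

lemma marked_iff:
  "marked f k \<longleftrightarrow> odd k \<and> (\<forall>i<list_len (k div 2). entry (k div 2) i = f i)"
  by (auto simp: marked_def eq_seq_code_iff)

locale recursive_coding_frame = coding_frame +
  assumes rec_nn: "recf (oracle_of F) 1 (\<lambda>xs. nn (xs ! 0))"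
    and rec_m: "recf (oracle_of F) 1 (\<lambda>xs. m (xs ! 0))"
begin

abbreviation "rf \<equiv> recf (oracle_of F)"
abbreviation "rp \<equiv> recp (oracle_of F)"

lemma recp_marked:
  assumes "rf k f" "rf k g"
  shows "rp k (\<lambda>xs. marked (half (entry (f xs))) (g xs))"
proof -
  have "rp 2 (\<lambda>ys. marked (half (entry (ys ! 0))) (ys ! 1))"
    unfolding marked_iff half_def
    by (intro rec_intros recp_even recf_half recf_entry recf_list_len) auto
  from recp_app2[OF this assms] show ?thesis .
qed

text \<open>
  Since F never vanishes, a finite sequence that satisfies the conditions on a parameter can be
  continued with zeros.
\<close>

lemma valid_code_iff:
  "valid_code v k \<longleftrightarrow> list_len v = k \<and> (\<forall>i<k. enat (entry v i div 2) < F (nn i)) \<and>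
     (\<forall>i<k. \<forall>j<k. odd (entry v i) \<and> odd (entry v j) \<longrightarrow> i = j)" (is "?L \<longleftrightarrow> ?R")
proof
  assume ?L
  then show ?R
    by (auto simp: valid_code_def params_def half_def list_len_seq_code entry_seq_code)
next
  assume R: ?R
  define \<psi> where "\<psi> i = (if i < k then entry v i else 0)" for i
  have "\<psi> \<in> P"
    using R F_pos by (auto simp: params_def half_def \<psi>_def enat_0 zero_less_iff_neq_zero)
  moreover have "v = seq_code \<psi> k"
    using R by (simp add: eq_seq_code_iff \<psi>_def)
  ultimately show ?L
    by (auto simp: valid_code_def)
qed

lemma recp_valid_code:
  assumes "rf k f" "rf k g"
  shows "rp k (\<lambda>xs. valid_code (f xs) (g xs))"
proof -
  have "rp 2 (\<lambda>ys. valid_code (ys ! 0) (ys ! 1))"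
    unfolding valid_code_iff
    by (intro recp_less_F recf_app1[OF rec_nn] rec_intros recp_even recf_half recf_entry recf_list_len)
      auto
  from recp_app2[OF this assms] show ?thesis .
qed

lemma below_iff:
  "below f j k \<longleftrightarrow> j < k \<and> marked f j \<and> valid_code (f k) k \<and> list_len (f j) = j \<and>
     (\<forall>i<j. entry (f j) i = entry (f k) i)"
proof (cases "j < k")
  case True
  have "f j = seq_code \<psi> j \<longleftrightarrow> list_len (f j) = j \<and> (\<forall>i<j. entry (f j) i = entry (f k) i)"
    if "f k = seq_code \<psi> k" for \<psi>
    using that True by (auto simp: eq_seq_code_iff[of "f j"] entry_seq_code)
  with True show ?thesis
    unfolding below_def valid_code_def by metis
qed (simp add: below_def)

lemma recp_below:
  assumes "rf k f" "rf k g" "rf k h"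
  shows "rp k (\<lambda>xs. below (half (entry (f xs))) (g xs) (h xs))"
proof -
  have "rp 3 (\<lambda>ys. below (half (entry (ys ! 0))) (ys ! 1) (ys ! 2))"
    unfolding below_iff half_def[of _ "_ ! _"]
    by (intro recp_marked recp_valid_code rec_intros recf_half recf_entry recf_list_len) auto
  from recp_app3[OF this assms] show ?thesis .
qed

lemma recp_copies:
  assumes "rf k f" "rf k g"
  shows "rp k (\<lambda>xs. copies (entry (f xs)) (g xs))"
proof -
  have "rp 2 (\<lambda>ys. copies (entry (ys ! 0)) (ys ! 1))"
    unfolding copies_def parent_def
    by (intro recp_marked recp_below rec_intros recp_even recf_half recf_entry) auto
  from recp_app2[OF this assms] show ?thesis .
qed

lemma recf_val:
  assumes "rf k f" "rf k g"
  shows "rf k (\<lambda>xs. val (entry (f xs)) (g xs))"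
proof -
  have "rf 2 (\<lambda>ys. val (entry (ys ! 0)) (ys ! 1))"
    unfolding val_def half_def
    by (intro recf_app1[OF rec_nn] recf_app1[OF rec_m] recp_copies recf_seq_code_entry
        rec_intros recf_half recf_entry) auto
  from recf_app2[OF this assms] show ?thesis .
qed

lemma recursive_tree: "recursive_in F tree"
proof (rule recursive_inI)
  have "list_decode e \<in> tree \<longleftrightarrow> (\<forall>x<list_len e. nn (m x) = x \<and> even (m x) \<longrightarrow>
     valid_code (list_nth e x) (m x) \<and>
     (\<forall>n<list_len e. m n < m x \<longrightarrow> list_nth e n = val (entry (list_nth e x)) n))" for e
    by (simp add: tree_def list_nth_eq flip: list_len_def)
  moreover have "rp 1 (\<lambda>ys. \<forall>x<list_len (ys ! 0). nn (m x) = x \<and> even (m x) \<longrightarrow>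
     valid_code (list_nth (ys ! 0) x) (m x) \<and>
     (\<forall>n<list_len (ys ! 0). m n < m x \<longrightarrow>
        list_nth (ys ! 0) n = val (entry (list_nth (ys ! 0) x)) n))"
    by (intro recf_app1[OF rec_nn] recf_app1[OF rec_m] recp_valid_code recf_val rec_intros
        recp_even recf_list_nth recf_list_len) auto
  ultimately show "rp 1 (\<lambda>ys. list_decode (ys ! 0) \<in> tree)" by simp
qed

lemma Pi01_family: "Pi01 F family"
  unfolding Pi01_def using is_tree_tree recursive_tree branches_tree by blast

end


section \<open>Two sequences of coding positions\<close>

text \<open>
  If F is eventually infinite, the whole final segment can serve as the sequence of positions.
\<close>

lemma recursive_coding_frame_shift:
  assumes F_pos: "\<And>n. F n \<noteq> 0" and inf: "\<And>n. N \<le> n \<Longrightarrow> F n = \<infinity>"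
  shows "recursive_coding_frame F (\<lambda>k. N + k) (\<lambda>n. n - N)"
proof unfold_locales
  show "finite {n. F n \<le> enat b}" for b
    by (rule finite_subset[of _ "{..<N}"]) (use inf in \<open>auto simp: not_le[symmetric]\<close>)
  show "finite {n. n - N \<le> b}" for b
    by (rule finite_subset[of _ "{..N + b}"]) auto
  show "enat (seq_code \<phi> (n - N)) < F n" for \<phi> n
  proof (cases "N \<le> n")
    case False
    then show ?thesis
      using F_pos[of n] by (simp add: seq_code_0 enat_0 zero_less_iff_neq_zero)
  qed (simp add: inf)
qed (auto simp: F_pos strict_mono_def intro!: rec_intros)

text \<open>
  If F is finite infinitely often, the positions are taken among the finite values, which keeps the
  family bounded at each place. As F need not have a recursive modulus of divergence, the next
  position is found by search: it is the first one past the previous position at which F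
  is finite and at least the bound for the codes of the next length. This bound depends on F at the
  earlier positions, so both are computed together, and a stage codes the pair of the least
  admissible position and the bound. The oracle returns the successor of a finite value of F, which
  is why a finite F n \<ge> b is expressed by b < oracle_of F n.
\<close>

definition next_pos :: "(nat \<Rightarrow> enat) \<Rightarrow> nat \<Rightarrow> nat" where
  "next_pos F e = (LEAST n. fst (prod_decode e) \<le> n \<and> snd (prod_decode e) < oracle_of F n)"

definition stage :: "(nat \<Rightarrow> enat) \<Rightarrow> nat \<Rightarrow> nat" where
  "stage F k = rec_nat (prod_encode (0, 1)) (\<lambda>i e. prod_encode (Suc (next_pos F e),
     Suc (Suc (prod_encode (2 * oracle_of F (next_pos F e), snd (prod_decode e)))))) k"

definition pos :: "(nat \<Rightarrow> enat) \<Rightarrow> nat \<Rightarrow> nat" where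
  "pos F k = next_pos F (stage F k)"

definition bound :: "(nat \<Rightarrow> enat) \<Rightarrow> nat \<Rightarrow> nat" where
  "bound F k = snd (prod_decode (stage F k))"

text \<open>
  Codes of length level F n fit below F n, because the search stops before the first length whose
  bound exceeds a finite F n. It also stops at the index of the next position, so that
  level F (pos F k) = k.
\<close>

definition level :: "(nat \<Rightarrow> enat) \<Rightarrow> nat \<Rightarrow> nat" where
  "level F n = (LEAST j. n \<le> pos F j \<or> (oracle_of F n \<noteq> 0 \<and> oracle_of F n \<le> bound F (Suc j)))"

context
  fixes F :: "nat \<Rightarrow> enat"
  assumes F_pos: "\<And>n. F n \<noteq> 0"
    and unbounded: "\<And>b. finite {n. F n \<le> enat b}"
    and inf_finite: "infinite {n. F n < \<infinity>}"
begin

lemma bound_0: "bound F 0 = 1"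
  by (simp add: bound_def stage_def)

lemma bound_Suc: "bound F (Suc k) = Suc (Suc (prod_encode (2 * oracle_of F (pos F k), bound F k)))"
  by (simp add: bound_def pos_def stage_def)

lemma ex_next_pos: "\<exists>n. a \<le> n \<and> b < oracle_of F n"
proof -
  have "infinite ({n. F n < \<infinity>} - ({n. F n \<le> enat b} \<union> {..<a}))"
    using inf_finite unbounded[of b] by (intro Diff_infinite_finite) auto
  then obtain n where "F n < \<infinity>" "\<not> F n \<le> enat b" "a \<le> n"
    by (metis (no_types, lifting) DiffD1 DiffD2 UnCI finite.emptyI ex_in_conv lessThan_iff
        mem_Collect_eq not_less)
  then show ?thesis
    by (intro exI[of _ n]) (auto simp: oracle_of_def split: enat.splits)
qed

lemma next_pos: "fst (prod_decode e) \<le> next_pos F e" "snd (prod_decode e) < oracle_of F (next_pos F e)"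
  using LeastI_ex[OF ex_next_pos[of "fst (prod_decode e)" "snd (prod_decode e)"]]
  unfolding next_pos_def by auto

lemma bound_less_oracle_pos: "bound F k < oracle_of F (pos F k)"
  using next_pos(2) by (simp add: bound_def pos_def)

lemma strict_mono_pos: "strict_mono (pos F)"
proof -
  have "pos F k < pos F (Suc k)" for k
    using next_pos(1)[of "stage F (Suc k)"] by (simp add: pos_def stage_def)
  then show ?thesis by (simp add: strict_mono_Suc_iff)
qed

lemma strict_mono_bound: "strict_mono (bound F)"
  by (simp add: strict_mono_Suc_iff bound_Suc less_Suc_eq_le le_SucI le_prod_encode_2)

lemma half_less_oracle:
  assumes "\<phi> \<in> params F (pos F)"
  shows "half \<phi> k < oracle_of F (pos F k)"
proof -
  have "enat (half \<phi> k) < F (pos F k)"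
    using assms by (simp add: params_def)
  with bound_less_oracle_pos[of k] show ?thesis
    by (auto simp: less_oracle_of)
qed

lemma seq_code_less_bound:
  assumes "\<phi> \<in> params F (pos F)"
  shows "seq_code \<phi> k < bound F k"
proof (induction k)
  case (Suc k)
  have "\<phi> k \<le> 2 * oracle_of F (pos F k)"
    using half_less_oracle[OF assms, of k] by (simp add: half_def)
  then have "prod_encode (\<phi> k, seq_code \<phi> k) \<le> prod_encode (2 * oracle_of F (pos F k), bound F k)"
    using Suc by (intro prod_encode_mono) auto
  then show ?case
    by (simp add: bound_Suc seq_code_Suc)
qed (simp add: seq_code_0 bound_0)

lemma ex_level: "\<exists>j. n \<le> pos F j \<or> (oracle_of F n \<noteq> 0 \<and> oracle_of F n \<le> bound F (Suc j))"
  using strict_mono_imp_increasing[OF strict_mono_pos] by blast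

lemma level_pos: "level F (pos F k) = k"
  unfolding level_def
proof (rule Least_equality)
  fix j
  assume j: "pos F k \<le> pos F j \<or>
      oracle_of F (pos F k) \<noteq> 0 \<and> oracle_of F (pos F k) \<le> bound F (Suc j)"
  show "k \<le> j"
  proof (rule ccontr)
    assume "\<not> k \<le> j"
    then have "pos F j < pos F k" "bound F (Suc j) \<le> bound F k"
      using strict_mono_pos strict_mono_bound by (simp_all add: strict_mono_less strict_mono_less_eq)
    with j bound_less_oracle_pos[of k] show False by auto
  qed
qed simp

lemma finite_level_le: "finite {n. level F n \<le> b}"
proof (rule finite_subset)
  show "{n. level F n \<le> b} \<subseteq> {..pos F b} \<union> {n. F n \<le> enat (bound F (Suc b))}"
  proof
    fix n
    assume "n \<in> {n. level F n \<le> b}"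
    then have le: "level F n \<le> b" by simp
    have "pos F (level F n) \<le> pos F b" "bound F (Suc (level F n)) \<le> bound F (Suc b)"
      using le strict_mono_pos strict_mono_bound by (simp_all add: strict_mono_less_eq)
    moreover have "n \<le> pos F (level F n) \<or>
        (oracle_of F n \<noteq> 0 \<and> oracle_of F n \<le> bound F (Suc (level F n)))"
      unfolding level_def by (rule LeastI_ex[OF ex_level])
    ultimately show "n \<in> {..pos F b} \<union> {n. F n \<le> enat (bound F (Suc b))}"
      by (auto simp: oracle_of_def split: enat.splits)
  qed
qed (use unbounded in auto)

lemma seq_code_level_less:
  assumes "\<phi> \<in> params F (pos F)"
  shows "enat (seq_code \<phi> (level F n)) < F n"
proof (cases "level F n")
  case 0
  then show ?thesis
    using F_pos[of n] by (simp add: seq_code_0 enat_0 zero_less_iff_neq_zero)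
next
  case (Suc j)
  then have "\<not> (oracle_of F n \<noteq> 0 \<and> oracle_of F n \<le> bound F (Suc j))"
    using not_less_Least[of j "\<lambda>j. n \<le> pos F j \<or> (oracle_of F n \<noteq> 0 \<and> oracle_of F n \<le> bound F (Suc j))"]
    by (simp add: level_def)
  with seq_code_less_bound[OF assms, of "Suc j"] show ?thesis
    by (auto simp: less_oracle_of Suc)
qed

lemma recf_next_pos:
  "recf (oracle_of F) k f \<Longrightarrow> recf (oracle_of F) k (\<lambda>xs. next_pos F (f xs))"
proof (rule recf_app1[of _ "next_pos F"])
  show "recf (oracle_of F) 1 (\<lambda>ys. next_pos F (ys ! 0))"
    unfolding next_pos_def
  proof (rule recf_Least)
    show "recp (oracle_of F) (Suc 1) (\<lambda>ys. fst (prod_decode (tl ys ! 0)) \<le> hd ys \<and>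
        snd (prod_decode (tl ys ! 0)) < oracle_of F (hd ys))"
      by (intro rec_intros recf_prod_decode) auto
  qed (rule ex_next_pos)
qed

lemma recf_stage:
  "recf (oracle_of F) k f \<Longrightarrow> recf (oracle_of F) k (\<lambda>xs. stage F (f xs))"
proof (rule recf_app1[of _ "stage F"])
  show "recf (oracle_of F) 1 (\<lambda>ys. stage F (ys ! 0))"
    unfolding stage_def
    by (intro recf_rec_nat recf_next_pos recf_prod_encode recf_prod_decode rec_intros) auto
qed

lemma recursive_coding_frame_search: "recursive_coding_frame F (pos F) (level F)"
proof unfold_locales
  show "recf (oracle_of F) 1 (\<lambda>xs. pos F (xs ! 0))"
    unfolding pos_def by (intro recf_next_pos recf_stage rec_intros) auto
  show "recf (oracle_of F) 1 (\<lambda>xs. level F (xs ! 0))"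
    unfolding level_def
  proof (rule recf_Least)
    show "recp (oracle_of F) (Suc 1) (\<lambda>ys. tl ys ! 0 \<le> pos F (hd ys) \<or>
        (oracle_of F (tl ys ! 0) \<noteq> 0 \<and> oracle_of F (tl ys ! 0) \<le> bound F (Suc (hd ys))))"
      unfolding pos_def bound_def
      by (intro recf_next_pos recf_stage recf_prod_decode rec_intros) auto
  qed (rule ex_level)
qed (use F_pos unbounded strict_mono_pos level_pos finite_level_le seq_code_level_less in auto)

interpretation search: recursive_coding_frame F "pos F" "level F"
  by (rule recursive_coding_frame_search)

lemma compact_family: "compactin (NF_topology F) search.family"
proof (rule compactin_bounded[OF search.closedin_family])
  fix g n
  assume "g \<in> search.family"
  then obtain \<phi> where \<phi>: "\<phi> \<in> params F (pos F)" "g = search.val \<phi>"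
    by (auto simp: search.family_def)
  show "g n \<le> max (oracle_of F n) (bound F (level F n))"
    using half_less_oracle[OF \<phi>(1), of "level F n"] seq_code_less_bound[OF \<phi>(1), of "level F n"]
    by (auto simp: \<phi>(2) search.val_def)
qed

lemma compact_perfect_med_exists:
  "\<exists>E. med_family F E \<and> compactin (NF_topology F) E \<and> perfect_in (NF_topology F) E \<and> Pi01 F E"
  using compact_family search.med_family_family search.perfect_family search.Pi01_family by blast

end

lemma perfect_med_exists:
  assumes "\<And>n. F n \<noteq> 0" "\<And>b. finite {n. F n \<le> enat b}"
  shows "\<exists>E. med_family F E \<and> perfect_in (NF_topology F) E \<and> Pi01 F E"
proof (cases "finite {n. F n < \<infinity>}")
  case True
  then obtain N where N: "\<And>n. F n < \<infinity> \<Longrightarrow> n < N"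
    by (auto simp: finite_nat_set_iff_bounded)
  then have "F n = \<infinity>" if "N \<le> n" for n
    using that by (meson enat_ord_simps(4) not_le)
  then interpret shift: recursive_coding_frame F "\<lambda>k. N + k" "\<lambda>n. n - N"
    using assms(1) by (intro recursive_coding_frame_shift)
  show ?thesis
    using shift.med_family_family shift.perfect_family shift.Pi01_family by blast
next
  case False
  then show ?thesis
    using compact_perfect_med_exists assms by blast
qed


section \<open>Countable and compact families\<close>

text \<open>
  Diagonalisation against an enumeration e: at n the new function avoids the values of e i for all
  i < n with i + 1 < F n, which are fewer than F n values. As F tends to infinity, each e i is
  avoided from some point on.
\<close>

lemma med_family_uncountable:
  assumes pos: "\<And>n. F n \<noteq> 0" and unbounded: "\<And>b. finite {n. F n \<le> enat b}"
    and E: "med_family F E"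
  shows "uncountable E"
proof
  assume "countable E"
  then obtain e :: "nat \<Rightarrow> nat \<Rightarrow> nat" where e: "E \<subseteq> range e"
    by (metis empty_subsetI range_from_nat_into order_refl)
  have "\<exists>x. enat x < F n \<and> (\<forall>i<n. enat (Suc i) < F n \<longrightarrow> e i n \<noteq> x)" for n
  proof -
    define V where "V = (\<lambda>i. e i n) ` {i. i < n \<and> enat (Suc i) < F n}"
    have "\<not> {x. enat x < F n} \<subseteq> V"
    proof (cases "F n")
      case (enat k)
      have "V \<subseteq> (\<lambda>i. e i n) ` {..<k - 1}"
        by (auto simp: V_def enat)
      then have "card V \<le> k - 1"
        by (metis card_image_le card_lessThan card_mono finite_imageI finite_lessThan le_trans)
      moreover have "k \<noteq> 0"
        using pos[of n] by (auto simp: enat zero_enat_def)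
      moreover have "finite V"
        by (simp add: V_def)
      ultimately show ?thesis
        using card_mono[of V "{..<k}"] by (auto simp: enat lessThan_def)
    next
      case infinity
      have "finite V" by (simp add: V_def)
      then show ?thesis
        using infinity finite_subset by auto
    qed
    then show ?thesis by (auto simp: V_def)
  qed
  then obtain g where g: "\<And>n. enat (g n) < F n"
    "\<And>n i. i < n \<Longrightarrow> enat (Suc i) < F n \<Longrightarrow> e i n \<noteq> g n"
    by metis
  have ed: "eventually_different (e i) g" for i
    unfolding eventually_different_def
  proof (rule finite_subset)
    show "{n. e i n = g n} \<subseteq> {..i} \<union> {n. F n \<le> enat (Suc i)}"
      using g(2) by (force simp: not_less[symmetric])
    show "finite ({..i} \<union> {n. F n \<le> enat (Suc i)})"
      using unbounded by simp
  qed
  have "g \<in> NF F"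
    using g(1) by (simp add: NF_def)
  then have "g \<in> E"
    using E ed e unfolding med_family_iff by blast
  then have "eventually_different g g"
    using ed e by blast
  then show False
    by (simp add: eventually_different_def)
qed

text \<open>
  The members of a compact set are bounded at each place. If F is infinite at all but finitely many
  places, a function that exceeds these bounds wherever F is infinite can be added.
\<close>

lemma compact_med_imp_infinite_finite_values:
  assumes pos: "\<And>n. F n \<noteq> 0" and E: "med_family F E" and compact: "compactin (NF_topology F) E"
  shows "infinite {n. F n < \<infinity>}"
proof
  assume fin: "finite {n. F n < \<infinity>}"
  have finV: "finite ((\<lambda>g. g n) ` E)" for n
  proof -
    have "continuous_map (NF_topology F) (discrete_topology {k. enat k < F n}) (\<lambda>g. g n)"
      unfolding NF_topology_def by (rule continuous_map_product_projection) simp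
    from image_compactin[OF compact this] show ?thesis
      by (simp add: compactin_discrete_topology)
  qed
  define h where "h n = (if F n = \<infinity> then Suc (Max ((\<lambda>g. g n) ` E)) else 0)" for n
  have "h \<in> NF F"
    using pos by (auto simp: NF_def h_def enat_0 zero_less_iff_neq_zero)
  have diff: "g n \<noteq> h n" if "g \<in> E" "F n = \<infinity>" for g n
    using Max_ge[OF finV, of "g n" n] that by (auto simp: h_def)
  have ed: "eventually_different g h" if "g \<in> E" for g
    unfolding eventually_different_def
  proof (rule finite_subset[OF _ fin])
    show "{n. g n = h n} \<subseteq> {n. F n < \<infinity>}"
      using diff[OF that] by auto
  qed
  then have "h \<in> E"
    using E \<open>h \<in> NF F\<close> unfolding med_family_iff by blast
  then show False
    using ed[of h] by (simp add: eventually_different_def)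
qed


section \<open>Finite limit inferior\<close>

lemma finite_not_eventually: "(\<forall>\<^sub>F n in sequentially. Q n) \<longleftrightarrow> finite {n. \<not> Q n}"
  unfolding cofinite_eq_sequentially[symmetric] eventually_cofinite ..

lemma less_enat_Suc_iff: "x < enat (Suc k) \<longleftrightarrow> x \<le> enat k"
  by (cases x) auto

lemma liminf_enat:
  fixes F :: "nat \<Rightarrow> enat"
  assumes "liminf F = enat K"
  shows "infinite {n. F n \<le> enat K}" and "finite {n. F n < enat K}"
proof -
  show "finite {n. F n < enat K}"
  proof (cases K)
    case (Suc k)
    have "\<forall>\<^sub>F n in sequentially. enat k < F n"
      using assms Suc by (intro less_LiminfD) simp
    then have "finite {n. \<not> enat k < F n}"
      by (simp only: finite_not_eventually)
    moreover have "{n. F n < enat K} \<subseteq> {n. \<not> enat k < F n}"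
      using Suc by (auto simp: not_less less_enat_Suc_iff)
    ultimately show ?thesis
      using finite_subset by blast
  qed (simp add: enat_0)
  show "infinite {n. F n \<le> enat K}"
  proof
    assume fin: "finite {n. F n \<le> enat K}"
    have "enat (Suc K) \<le> liminf F"
      unfolding le_Liminf_iff
    proof (intro allI impI)
      fix y :: enat
      assume "y < enat (Suc K)"
      then have "y \<le> enat K"
        by (simp add: less_enat_Suc_iff)
      then have "{n. \<not> y < F n} \<subseteq> {n. F n \<le> enat K}"
        by auto
      then show "\<forall>\<^sub>F n in sequentially. y < F n"
        unfolding finite_not_eventually using fin finite_subset by blast
    qed
    with assms show False by simp
  qed
qed

lemma liminf_infinity:
  fixes F :: "nat \<Rightarrow> enat"
  assumes "liminf F = \<infinity>"
  shows "finite {n. F n \<le> enat b}"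
proof -
  have "\<forall>\<^sub>F n in sequentially. enat b < F n"
    using assms by (intro less_LiminfD) simp
  then show ?thesis
    by (simp add: finite_not_eventually not_less)
qed

text \<open>
  The constant function c, cut down to the largest admissible value where F n \<le> c. Such an F n is
  finite and the oracle returns F n + 1 for it, so the largest admissible value F n - 1 is the
  oracle's answer minus 2.
\<close>

definition trunc :: "(nat \<Rightarrow> enat) \<Rightarrow> nat \<Rightarrow> nat \<Rightarrow> nat" where
  "trunc F c n = (if enat c < F n then c else oracle_of F n - 2)"

context
  fixes F :: "nat \<Rightarrow> enat" and K :: nat
  assumes pos: "\<And>n. F n \<noteq> 0"
    and often: "infinite {n. F n \<le> enat K}"
    and rarely: "finite {n. F n < enat K}"
begin

lemma trunc_eq: "c < K \<Longrightarrow> \<not> F n < enat K \<Longrightarrow> trunc F c n = c"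
  by (metis trunc_def enat_ord_simps(2) not_less less_le_trans)

lemma trunc_in_NF: "trunc F c \<in> NF F"
proof -
  have "enat (trunc F c n) < F n" for n
    using pos[of n] by (auto simp: trunc_def oracle_of_def zero_enat_def split: enat.splits)
  then show ?thesis by (simp add: NF_def)
qed

text \<open>
  At infinitely many places every function below F has a value less than K, so by the pigeonhole
  principle it takes one of these values infinitely often.
\<close>

lemma med_family_trunc: "med_family F (trunc F ` {..<K})"
  unfolding med_family_iff
proof (intro conjI ballI impI)
  have "eventually_different (trunc F c) (trunc F d)" if "c < K" "d < K" "c \<noteq> d" for c d
    unfolding eventually_different_def
  proof (rule finite_subset[OF _ rarely])
    show "{n. trunc F c n = trunc F d n} \<subseteq> {n. F n < enat K}"
    proof (intro subsetI CollectI, rule ccontr)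
      fix n
      assume "n \<in> {n. trunc F c n = trunc F d n}" "\<not> F n < enat K"
      with trunc_eq[OF that(1), of n] trunc_eq[OF that(2), of n] that(3) show False
        by simp
    qed
  qed
  then show "ed_family F (trunc F ` {..<K})"
    unfolding ed_family_def using trunc_in_NF by blast
next
  fix g
  assume g: "g \<in> NF F" and ed: "\<forall>h\<in>trunc F ` {..<K}. h \<noteq> g \<longrightarrow> eventually_different h g"
  let ?S = "{n. F n \<le> enat K} - {n. F n < enat K}"
  have "infinite ?S"
    using often rarely by (intro Diff_infinite_finite)
  have less: "g n < K" if "n \<in> ?S" for n
  proof -
    have "enat (g n) < F n"
      using g by (simp add: NF_def)
    also have "F n \<le> enat K"
      using that by simp
    finally show ?thesis by simp
  qed
  have "g ` ?S \<subseteq> {..<K}"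
    using less by blast
  then have "finite (g ` ?S)"
    using finite_subset by blast
  then obtain n where n: "n \<in> ?S" "infinite {x \<in> ?S. g x = g n}"
    using pigeonhole_infinite[OF \<open>infinite ?S\<close>] by blast
  have "{x \<in> ?S. g x = g n} \<subseteq> {x. trunc F (g n) x = g x}"
    using less[OF n(1)] trunc_eq by auto
  then have "\<not> eventually_different (trunc F (g n)) g"
    unfolding eventually_different_def using n(2) finite_subset by blast
  then have "trunc F (g n) = g"
    using ed less[OF n(1)] by blast
  then show "g \<in> trunc F ` {..<K}"
    using less[OF n(1)] by force
qed

text \<open>
  K + 1 pairwise eventually different functions would have distinct values below K at some place.
\<close>

lemma ed_family_finite:
  assumes E: "ed_family F E"
  shows "finite E"
proof (rule ccontr)
  assume "infinite E"
  then obtain S where S: "S \<subseteq> E" "finite S" "card S = Suc K"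
    using infinite_arbitrarily_large by blast
  let ?D = "\<Union>(g, h)\<in>{(g, h) \<in> S \<times> S. g \<noteq> h}. {n. g n = h n}"
  have "finite {(g, h) \<in> S \<times> S. g \<noteq> h}"
    by (rule finite_subset[of _ "S \<times> S"]) (use S(2) in auto)
  then have "finite ?D"
    using E S(1) unfolding ed_family_def eventually_different_def by (intro finite_UN_I) auto
  then obtain n where n: "F n \<le> enat K" "n \<notin> ?D"
    using often by (metis (mono_tags, lifting) finite_subset mem_Collect_eq subsetI)
  have "inj_on (\<lambda>g. g n) S"
    using n(2) by (auto simp: inj_on_def)
  then have "card S \<le> card {..<K}"
  proof (rule card_inj_on_le)
    have "g n < K" if "g \<in> S" for g
    proof -
      have "enat (g n) < F n"
        using that S(1) E unfolding ed_family_def NF_def by blast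
      also note n(1)
      finally show ?thesis by simp
    qed
    then show "(\<lambda>g. g n) ` S \<subseteq> {..<K}" by blast
  qed simp
  with S(3) show False by simp
qed

lemma eventually_constant_trunc: "c < K \<Longrightarrow> eventually_constant_fun (trunc F c)"
  unfolding eventually_constant_fun_def
  by (intro exI[of _ c] finite_subset[OF _ rarely]) (use trunc_eq in blast)

lemma Pi01_trunc: "Pi01 F (trunc F ` {..<K})"
  unfolding Pi01_def
proof (intro exI conjI)
  let ?T = "{s. \<exists>c<K. \<forall>i<length s. s ! i = trunc F c i}"
  show "is_tree ?T"
    unfolding is_tree_def
  proof (intro ballI allI impI)
    fix t s
    assume "t \<in> ?T" and "prefix s t"
    then obtain c u where c: "c < K" "\<forall>i<length t. t ! i = trunc F c i" and u: "t = s @ u"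
      by (auto simp: prefix_def)
    have "s ! i = trunc F c i" if "i < length s" for i
      using c(2)[rule_format, of i] that by (simp add: u nth_append)
    with c(1) show "s \<in> ?T" by blast
  qed
  show "recursive_in F ?T"
  proof (rule recursive_inI)
    have "recp (oracle_of F) 1 (\<lambda>xs. \<exists>c<K. \<forall>i<list_len (xs ! 0).
        list_nth (xs ! 0) i = trunc F c i)"
      unfolding trunc_def
      by (intro recp_less_F recf_list_len recf_list_nth rec_intros) auto
    then show "recp (oracle_of F) 1 (\<lambda>xs. list_decode (xs ! 0) \<in> ?T)"
      by (simp add: list_nth_eq flip: list_len_def)
  qed
  show "trunc F ` {..<K} = branches ?T"
  proof (intro equalityI subsetI)
    fix h
    assume "h \<in> branches ?T"
    then have h: "\<exists>c<K. \<forall>i<n. h i = trunc F c i" for n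
      by (simp add: branches_def)
    show "h \<in> trunc F ` {..<K}"
    proof (rule ccontr)
      assume "h \<notin> trunc F ` {..<K}"
      then have "\<forall>c. \<exists>i. c < K \<longrightarrow> h i \<noteq> trunc F c i"
        by (metis (no_types, lifting) ext imageI lessThan_iff)
      then obtain i where i: "\<And>c. c < K \<Longrightarrow> h (i c) \<noteq> trunc F c (i c)"
        by metis
      obtain n where "\<And>c. c < K \<Longrightarrow> i c < n"
        using finite_nat_set_iff_bounded[of "i ` {..<K}"] by auto
      with h[of n] i show False by blast
    qed
  qed (auto simp: branches_def)
qed

end


section \<open>The dichotomy\<close>

theorem corollary1p3:
  fixes F :: "nat \<Rightarrow> enat"
  assumes "\<And>n. F n \<noteq> 0"
  shows "((\<exists>E. med_family F E \<and> compactin (NF_topology F) E \<and> Pi01 F E)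
            \<longleftrightarrow> infinite {n. F n < \<infinity>})
       \<and> ((all_med_finite F \<and> \<not> perfect_med_none_countable F)
            \<or> (\<not> all_med_finite F \<and> perfect_med_none_countable F))
       \<and> (all_med_finite F \<longleftrightarrow> liminf F < \<infinity>)
       \<and> (liminf F < \<infinity> \<and> (\<forall>n. liminf F \<le> F n) \<longrightarrow>
            (\<exists>E. med_family F E \<and> finite E \<and> (\<forall>g\<in>E. constant_fun g)))"
proof (cases "liminf F")
  case (enat K)
  note K = liminf_enat[OF enat]
  let ?E = "trunc F ` {..<K}"
  have med: "med_family F ?E" and Pi: "Pi01 F ?E"
    using med_family_trunc[OF assms K] Pi01_trunc[OF assms K] by auto
  have all: "all_med_finite F"
    unfolding all_med_finite_def
    using med ed_family_finite[OF assms K] eventually_constant_trunc[OF assms K]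
    by (auto simp: med_family_def)
  have not_perfect: "\<not> perfect_med_none_countable F"
    unfolding perfect_med_none_countable_def using med by (auto intro: countable_finite)
  have "compactin (NF_topology F) ?E"
    using med by (intro finite_imp_compactin)
      (auto simp: topspace_NF_topology med_family_def ed_family_def)
  moreover have "infinite {n. F n < \<infinity>}"
    using K(1) by (rule infinite_super[rotated]) (auto elim!: enat_ile)
  moreover have "\<forall>g\<in>?E. constant_fun g" if "\<forall>n. liminf F \<le> F n"
  proof -
    have "trunc F c n = c" if "c < K" for c n
      using trunc_eq[OF assms K that, of n] \<open>\<forall>n. liminf F \<le> F n\<close> enat by (simp add: not_less)
    then show ?thesis
      by (auto simp: constant_fun_def)
  qed
  ultimately show ?thesis
    using med Pi all not_perfect enat by auto
next
  case infinity
  note unb = liminf_infinity[OF infinity]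
  have unc: "uncountable E" if "med_family F E" for E
    using med_family_uncountable[OF assms unb that] .
  then have perfect: "perfect_med_none_countable F"
    unfolding perfect_med_none_countable_def using perfect_med_exists[OF assms unb] by blast
  have not_all: "\<not> all_med_finite F"
    unfolding all_med_finite_def using unc countable_finite by blast
  have "(\<exists>E. med_family F E \<and> compactin (NF_topology F) E \<and> Pi01 F E) \<longleftrightarrow> infinite {n. F n < \<infinity>}"
    using compact_med_imp_infinite_finite_values[of F, OF assms] compact_perfect_med_exists[OF assms unb]
    by blast
  then show ?thesis
    using perfect not_all infinity by simp
qed

end
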